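(* Let $d=(d_1,\dots,d_t)$ with $t>1$ be a sequence of positive integers. Then, up to combinatorial equivalence, $d$ is the central signature of a unique even-near-critical centrally symmetric allowable sequence $\Pi$ in noncentral general position.
   Context: An allowable sequence on a finite set of $N$ points is a doubly infinite sequence $\Pi=\{\pi_i\}_{i\in\mathbb{Z}}$ of permutations (linear orderings) of the points such that: (i) there is a positive integer $h=h(\Pi)$ such that $\pi_{i+h}$ is the reversal of $\pi_i$ for all $i$ (then $\pi_0,\dots,\pi_h$ is called a halfperiod, of length $h$); (ii) $\pi_i$ is obtained from $\pi_{i-1}$ by reversing one or more disjoint substrings of consecutive elements; these reversals are called switches, and the set of switches from $\pi_{i-1}$ to $\pi_i$ is the $i$-th move; (iii) any pair of points participates together in a switch exactly once within a halfperiod. A switch of two points is a transposition. Write $\pi(p)$ for the position of the point $p$ in $\pi$. An allowable sequence with $2n$ points is centrally symmetric if for every point $p$ there is a point $\overline p$ (its conjugate) with $\pi(p)+\pi(\overline p)=2n+1$ for every permutation $\pi$ of the sequence. A crossing switch is a switch reversing a centered substring of a permutation. The sequence is in noncentral general position if all switches except possibly crossing switches are transpositions. It is even-near-critical if $h(\Pi)=2n$. Its central signature is $(d_1,\dots,d_t)$, where $2d_i$ is the number of points reversed by the $i$-th crossing switch in the halfperiod $\pi_0,\pi_1,\dots,\pi_h$; it is regarded as a cyclic sequence (starting the halfperiod elsewhere rotates it cyclically). Two allowable sequences $\{\pi_i\}$ and $\{\pi'_i\}$ are combinatorially equivalent if there are a bijection $f$ between their point sets and an integer $m$ such that $\pi'_{i+m}$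 is obtained from $\pi_i$ by applying $f$ to each entry, for all $i\in\mathbb{Z}$. *)

theory Defs
  imports "HOL-Combinatorics.Multiset_Permutations"
begin

text \<open>
  A permutation of the point set \<open>P\<close> is a list enumerating \<open>P\<close> without repetition, i.e. an element
  of \<open>permutations_of_set P\<close>; positions are counted from 1.
\<close>

definition pos :: "'a list \<Rightarrow> 'a \<Rightarrow> nat"
  where "pos xs p = Suc (length (takeWhile (\<lambda>x. x \<noteq> p) xs))"

lemma pos_eq_iff:
  assumes "distinct xs" and "p \<in> set xs"
  shows "pos xs p = k \<longleftrightarrow> 1 \<le> k \<and> k \<le> length xs \<and> xs ! (k - 1) = p"
proof -
  let ?m = "length (takeWhile (\<lambda>x. x \<noteq> p) xs)"
  obtain us vs where xs: "xs = us @ p # vs" "p \<notin> set us"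
    using split_list_first[OF assms(2)] by blast
  have "takeWhile (\<lambda>x. x \<noteq> p) xs = us"
    using xs by (subst xs(1), subst takeWhile_append2) auto
  then have m: "?m < length xs" "xs ! ?m = p" using xs by simp_all
  show ?thesis
  proof
    assume "pos xs p = k"
    then have "k = Suc ?m" by (simp add: pos_def)
    then show "1 \<le> k \<and> k \<le> length xs \<and> xs ! (k - 1) = p" using m by simp
  next
    assume k: "1 \<le> k \<and> k \<le> length xs \<and> xs ! (k - 1) = p"
    then have "k - 1 = ?m"
      using m assms(1) by (intro iffD1[OF nth_eq_iff_index_eq[OF assms(1)]]) auto
    then have "k = Suc ?m" using k by linarith
    then show "pos xs p = k" by (simp only: pos_def)
  qed
qed

text \<open>
  Reversing disjoint substrings of \<open>xs\<close> is encoded by cutting \<open>xs\<close> into consecutive nonempty blocks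
  and reversing each of them; the blocks of length 1 are the points that are not moved, the
  blocks of length at least 2 are the reversed substrings. For a list without repetitions the
  blocks are determined by \<open>xs\<close> and \<open>ys\<close> (lemma \<open>reverses_blocks_unique\<close>), hence so are the
  switches. A switch is represented by its substring as it occurs in the earlier permutation.
\<close>

definition reverses_blocks :: "'a list list \<Rightarrow> 'a list \<Rightarrow> 'a list \<Rightarrow> bool"
  where "reverses_blocks bs xs ys \<longleftrightarrow> [] \<notin> set bs \<and> xs = concat bs \<and> ys = concat (map rev bs)"

definition switches :: "'a list \<Rightarrow> 'a list \<Rightarrow> 'a list set"
  where "switches xs ys = {b. \<exists>bs. reverses_blocks bs xs ys \<and> b \<in> set bs \<and> 2 \<le> length b}"

lemma reverses_blocks_unique:
  assumes "distinct xs" "reverses_blocks bs xs ys" "reverses_blocks cs xs ys"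
  shows "bs = cs"
  using assms
proof (induction bs arbitrary: xs ys cs)
  case Nil
  then show ?case by (cases cs) (auto simp: reverses_blocks_def)
next
  case (Cons b bs)
  obtain c cs' where cs: "cs = c # cs'"
    using Cons.prems by (cases cs) (auto simp: reverses_blocks_def)
  have ne: "b \<noteq> []" "c \<noteq> []" using Cons.prems cs by (auto simp: reverses_blocks_def)
  have x: "xs = b @ concat bs" "xs = c @ concat cs'"
    and y: "ys = rev b @ concat (map rev bs)" "ys = rev c @ concat (map rev cs')"
    using Cons.prems cs by (auto simp: reverses_blocks_def)
  have "hd ys = last b" by (subst y(1)) (simp add: ne hd_rev)
  moreover have "hd ys = last c" by (subst y(2)) (simp add: ne hd_rev)
  ultimately have lst: "last b = last c" by simp
  have "length b - 1 = length c - 1"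
  proof -
    have "0 < length b" "0 < length c" using ne by simp_all
    moreover have "length xs = length b + length (concat bs)" "length xs = length c + length (concat cs')"
      using arg_cong[OF x(1), of length] arg_cong[OF x(2), of length]
      by (simp_all only: length_append)
    ultimately have "length b - 1 < length xs" "length c - 1 < length xs" by linarith+
    moreover have "xs ! (length b - 1) = last b" using x(1) ne by (simp add: nth_append last_conv_nth)
    moreover have "xs ! (length c - 1) = last c" using x(2) ne by (simp add: nth_append last_conv_nth)
    ultimately show ?thesis using lst
        nth_eq_iff_index_eq[OF Cons.prems(1), of "length b - 1" "length c - 1"] by metis
  qed
  then have "length b = length c"
    using ne[folded length_greater_0_conv] by linarith
  then have bc: "b = c" and t: "concat bs = concat cs'" using x by auto
  have ys': "concat (map rev bs) = concat (map rev cs')" using y bc by simp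
  have "distinct (concat bs)" using Cons.prems(1) x(1) by simp
  moreover have "reverses_blocks bs (concat bs) (concat (map rev bs))"
    "reverses_blocks cs' (concat bs) (concat (map rev bs))"
    using Cons.prems t ys' cs by (simp_all add: reverses_blocks_def)
  ultimately have "bs = cs'" by (rule Cons.IH)
  then show ?case using bc cs by simp
qed

text \<open>
  \<open>allowable_with P \<pi> h\<close>: \<open>\<pi>\<close> is an allowable sequence on \<open>P\<close> whose halfperiods have length \<open>h\<close>. The
  number \<open>h\<close> is determined by \<open>\<pi>\<close> (lemma \<open>allowable_with_unique\<close>).
\<close>

definition allowable_with :: "'a set \<Rightarrow> (int \<Rightarrow> 'a list) \<Rightarrow> nat \<Rightarrow> bool"
  where "allowable_with P \<pi> h \<longleftrightarrow>
    finite P \<and> (\<forall>i. \<pi> i \<in> permutations_of_set P) \<and>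
    0 < h \<and> (\<forall>i. \<pi> (i + int h) = rev (\<pi> i)) \<and>
    (\<forall>i. switches (\<pi> (i - 1)) (\<pi> i) \<noteq> {}) \<and>
    (\<forall>p\<in>P. \<forall>q\<in>P. p \<noteq> q \<longrightarrow>
      (\<exists>!i. i \<in> {1..int h} \<and> (\<exists>b\<in>switches (\<pi> (i - 1)) (\<pi> i). p \<in> set b \<and> q \<in> set b)))"

definition allowable_sequence :: "'a set \<Rightarrow> (int \<Rightarrow> 'a list) \<Rightarrow> bool"
  where "allowable_sequence P \<pi> \<longleftrightarrow> (\<exists>h. allowable_with P \<pi> h)"

definition halfperiod_length :: "'a set \<Rightarrow> (int \<Rightarrow> 'a list) \<Rightarrow> nat"
  where "halfperiod_length P \<pi> = (THE h. allowable_with P \<pi> h)"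

lemma allowable_with_le:
  assumes A: "allowable_with P \<pi> h" and B: "allowable_with P \<pi> h'"
  shows "h' \<le> h"
proof (rule ccontr)
  let ?sw = "\<lambda>p q i. \<exists>b\<in>switches (\<pi> (i - 1)) (\<pi> i). p \<in> set b \<and> q \<in> set b"
  assume "\<not> h' \<le> h"
  then have lt: "h < h'" by simp
  obtain b bs where b: "b \<in> switches (\<pi> (int h + 1 - 1)) (\<pi> (int h + 1))"
    and bs: "reverses_blocks bs (\<pi> (int h + 1 - 1)) (\<pi> (int h + 1))" "b \<in> set bs" "2 \<le> length b"
    using A unfolding allowable_with_def switches_def by blast
  have perm: "distinct (\<pi> (int h + 1 - 1))" "set (\<pi> (int h + 1 - 1)) = P"
    using A by (auto simp: allowable_with_def permutations_of_set_def)
  have "distinct b" "set b \<subseteq> P"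
    using bs perm by (auto simp: reverses_blocks_def distinct_concat_iff)
  moreover obtain p q r where "b = p # q # r"
    using bs(3) by (metis Suc_le_length_iff numeral_2_eq_2)
  ultimately have pq: "p \<in> P" "q \<in> P" "p \<noteq> q" and "p \<in> set b" "q \<in> set b"
    by auto
  then have sw: "?sw p q (int h + 1)" using b by blast
  have one: "\<exists>!i. i \<in> {1..int k} \<and> ?sw p q i" if "allowable_with P \<pi> k" for k
    using that[unfolded allowable_with_def, THEN conjunct2, THEN conjunct2, THEN conjunct2,
        THEN conjunct2, THEN conjunct2] pq by simp
  obtain i where "i \<in> {1..int h}" "?sw p q i"
    using ex1_implies_ex[OF one[OF A]] by (elim exE conjE)
  moreover note one[OF B]
  moreover have "int h + 1 \<in> {1..int h'}" using lt by auto
  moreover have "i \<in> {1..int h'}" using \<open>i \<in> {1..int h}\<close> lt by auto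
  ultimately have "i = int h + 1" using sw by (elim ex1E) metis
  then show False using \<open>i \<in> {1..int h}\<close> by simp
qed

lemma allowable_with_unique:
  "allowable_with P \<pi> h \<Longrightarrow> allowable_with P \<pi> h' \<Longrightarrow> h = h'"
  by (simp add: allowable_with_le order_antisym)

lemma halfperiod_length_eq:
  "allowable_with P \<pi> h \<Longrightarrow> halfperiod_length P \<pi> = h"
  unfolding halfperiod_length_def by (blast intro: the_equality allowable_with_unique)

definition centrally_symmetric :: "'a set \<Rightarrow> (int \<Rightarrow> 'a list) \<Rightarrow> bool"
  where "centrally_symmetric P \<pi> \<longleftrightarrow>
    (\<exists>n. card P = 2 * n \<and> (\<forall>p\<in>P. \<exists>q\<in>P. \<forall>i. pos (\<pi> i) p + pos (\<pi> i) q = 2 * n + 1))"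

definition even_near_critical :: "'a set \<Rightarrow> (int \<Rightarrow> 'a list) \<Rightarrow> bool"
  where "even_near_critical P \<pi> \<longleftrightarrow> (\<exists>n. card P = 2 * n \<and> halfperiod_length P \<pi> = 2 * n)"

definition centered_substring :: "'a list \<Rightarrow> 'a list \<Rightarrow> bool"
  where "centered_substring xs b \<longleftrightarrow> (\<exists>us vs. xs = us @ b @ vs \<and> length us = length vs)"

definition crossing_switches :: "'a list \<Rightarrow> 'a list \<Rightarrow> 'a list set"
  where "crossing_switches xs ys = {b \<in> switches xs ys. centered_substring xs b}"

definition noncentral_general_position :: "(int \<Rightarrow> 'a list) \<Rightarrow> bool"
  where "noncentral_general_position \<pi> \<longleftrightarrow>
    (\<forall>i. \<forall>b \<in> switches (\<pi> (i - 1)) (\<pi> i) - crossing_switches (\<pi> (i - 1)) (\<pi> i). length b = 2)"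

lemma crossing_switches_unique:
  assumes "distinct xs" "b \<in> crossing_switches xs ys" "c \<in> crossing_switches xs ys"
  shows "b = c"
proof (rule ccontr)
  assume "b \<noteq> c"
  have len: "2 \<le> length b" "2 \<le> length c"
    using assms by (auto simp: crossing_switches_def switches_def)
  obtain bs cs where bs: "reverses_blocks bs xs ys" "b \<in> set bs"
    and cs: "reverses_blocks cs xs ys" "c \<in> set cs"
    using assms by (auto simp: crossing_switches_def switches_def)
  have "bs = cs" using assms(1) bs cs reverses_blocks_unique by blast
  moreover have "set b \<inter> set c = {}" if "b \<in> set bs" "c \<in> set bs"
    using assms(1) bs(1) that \<open>b \<noteq> c\<close> by (auto simp: reverses_blocks_def distinct_concat_iff)
  ultimately have disj: "set b \<inter> set c = {}" using bs cs by blast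
  obtain us vs where u: "xs = us @ b @ vs" "length us = length vs"
    using assms(2) by (auto simp: crossing_switches_def centered_substring_def)
  obtain us' vs' where u': "xs = us' @ c @ vs'" "length us' = length vs'"
    using assms(3) by (auto simp: crossing_switches_def centered_substring_def)
  define m where "m = length xs div 2"
  have l: "length xs = 2 * length us + length b" "length xs = 2 * length us' + length c"
    using u(2) u'(2) arg_cong[OF u(1), of length] arg_cong[OF u'(1), of length] by auto
  have "length us \<le> m" "m - length us < length b" "length us' \<le> m" "m - length us' < length c"
    using l len by (auto simp: m_def)
  then have "(us @ b @ vs) ! m \<in> set b" "(us' @ c @ vs') ! m \<in> set c"
    by (simp_all add: nth_append)
  then have "xs ! m \<in> set b" "xs ! m \<in> set c"
    using u(1) u'(1) by simp_all
  then show False using disj by auto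
qed

text \<open>
  The list of the numbers \<open>d\<close>, in order, such that one of the moves \<open>1, \<dots>, h\<close> contains a crossing
  switch of \<open>2 * d\<close> points. A move contains at most one crossing switch (lemma
  \<open>crossing_switches_unique\<close>).
\<close>

definition central_signature :: "'a set \<Rightarrow> (int \<Rightarrow> 'a list) \<Rightarrow> nat list"
  where "central_signature P \<pi> =
    map (\<lambda>i. length (the_elem (crossing_switches (\<pi> (i - 1)) (\<pi> i))) div 2)
      (filter (\<lambda>i. crossing_switches (\<pi> (i - 1)) (\<pi> i) \<noteq> {})
        [1..int (halfperiod_length P \<pi>)])"

text \<open>The central signature is a cyclic sequence, hence the rotation.\<close>

definition has_central_signature :: "'a set \<Rightarrow> (int \<Rightarrow> 'a list) \<Rightarrow> nat list \<Rightarrow> bool"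
  where "has_central_signature P \<pi> d \<longleftrightarrow> (\<exists>k. d = rotate k (central_signature P \<pi>))"

definition combinatorially_equivalent ::
    "'a set \<Rightarrow> (int \<Rightarrow> 'a list) \<Rightarrow> 'b set \<Rightarrow> (int \<Rightarrow> 'b list) \<Rightarrow> bool"
  where "combinatorially_equivalent P \<pi> Q \<pi>' \<longleftrightarrow>
    (\<exists>f m. bij_betw f P Q \<and> (\<forall>i. \<pi>' (i + m) = map f (\<pi> i)))"

definition realizes :: "'a set \<Rightarrow> (int \<Rightarrow> 'a list) \<Rightarrow> nat list \<Rightarrow> bool"
  where "realizes P \<pi> d \<longleftrightarrow>
    allowable_sequence P \<pi> \<and> centrally_symmetric P \<pi> \<and> even_near_critical P \<pi> \<and>
    noncentral_general_position \<pi> \<and> has_central_signature P \<pi> d"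

end

theory Submission
  imports Defs
begin

text \<open>
  Measure a point by its signed position: the \<open>k\<close>-th place to the right of the centre is height
  \<open>k\<close>, its mirror image is height \<open>-k\<close>. Conjugate points have opposite heights. A crossing switch
  of \<open>2 e\<close> points negates the heights of absolute value at most \<open>e\<close>; any other point keeps its sign
  in a move and changes its height by at most one. Conjugate points can only meet in a crossing
  switch, so in \<open>2 n\<close> moves every point changes sign exactly once.

  Uniqueness. Follow the points \<open>x\<^sub>1, \<dots>, x\<^sub>e\<close> that are at heights \<open>1, \<dots>, e\<close> just after a crossing
  switch of \<open>2 e\<close> points. They have been reversed in it, so they keep their order during the
  following \<open>2 n - 1\<close> moves, and \<open>x\<^sub>j\<close> can rise only when there is a gap above it. Hence \<open>s\<close> moves
  later \<open>x\<^sub>j\<close> is at height at most \<open>max j (2 j - e + s)\<close>. The same holds backwards in time from the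
  next sign change, and \<open>x\<^sub>j\<close> is at least \<open>e - j\<close> places below the top because \<open>x\<^sub>j\<^sub>+\<^sub>1, \<dots>, x\<^sub>e\<close> are above
  it. Together these bounds form a function \<open>profile\<close> of \<open>s\<close> (lemma \<open>profile_bound\<close>). It has two
  consequences.

  First, \<open>x\<^sub>1\<close> has to leave the centre before the next crossing switch, of \<open>2 e'\<close> points say, so
  that switch is at least \<open>e + e'\<close> moves later (lemma \<open>crossing_gap\<close>). Going once around, the gaps
  add up to \<open>2 n\<close>, and their lower bounds to twice the sum of the signature, which is at least
  \<open>2 n\<close> because every point crosses. So all gaps are exactly \<open>e + e'\<close>: up to a shift, the signature
  determines the crossing times.

  Second, the profiles that belong to these crossing times are pairwise different at any moment,
  so the positive ones are the numbers \<open>1, \<dots>, n\<close> in some order. The actual positive heights are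
  these numbers too and are bounded by the profiles one by one; having the same sum, they are equal
  to them. So the height of every point at every time is known (lemma \<open>heights_determined\<close>).

  Existence. Take the profiles as a definition of the motion. That heights are pairwise different
  is a parity argument (lemma \<open>profile_neq\<close>); that two points switch only once holds because,
  after one has overtaken the other, the upper one does not fall while the lower one
  rises (lemma \<open>separated_order_monotone\<close>); and a permutation in which nobody is displaced by more
  than one place consists of disjoint transpositions of neighbours (lemma
  \<open>adjacent_transpositions\<close>).
\<close>

section \<open>Positions and reversed blocks\<close>

lemma pos_append: "pos (us @ vs) p = (if p \<in> set us then pos us p else length us + pos vs p)"
proof (cases "p \<in> set us")
  case True
  then show ?thesis by (simp add: pos_def takeWhile_append1[of p])
next
  case False
  then have "takeWhile (\<lambda>x. x \<noteq> p) (us @ vs) = us @ takeWhile (\<lambda>x. x \<noteq> p) vs"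
    by (intro takeWhile_append2) auto
  then show ?thesis using False by (simp add: pos_def)
qed

lemma pos_bounds: "distinct xs \<Longrightarrow> p \<in> set xs \<Longrightarrow> 1 \<le> pos xs p \<and> pos xs p \<le> length xs"
  using pos_eq_iff[of xs p "pos xs p"] by simp

lemma nth_pos: "distinct xs \<Longrightarrow> p \<in> set xs \<Longrightarrow> xs ! (pos xs p - 1) = p"
  using pos_eq_iff[of xs p "pos xs p"] by simp

lemma pos_nth: "distinct xs \<Longrightarrow> k < length xs \<Longrightarrow> pos xs (xs ! k) = Suc k"
  by (subst pos_eq_iff) auto

lemma pos_inj: "distinct xs \<Longrightarrow> p \<in> set xs \<Longrightarrow> q \<in> set xs \<Longrightarrow> pos xs p = pos xs q \<Longrightarrow> p = q"
  by (metis nth_pos)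

lemma pos_rev:
  assumes "distinct b" "p \<in> set b"
  shows "pos (rev b) p + pos b p = length b + 1"
proof -
  let ?k = "pos b p"
  have k: "1 \<le> ?k" "?k \<le> length b" "b ! (?k - 1) = p"
    using pos_eq_iff[OF assms, of "pos b p"] by simp_all
  have "rev b ! (length b - ?k) = p"
    using k by (simp add: rev_nth)
  then have "pos (rev b) p = Suc (length b - ?k)"
    using k assms by (metis pos_nth distinct_rev length_rev diff_less less_le_trans zero_less_one)
  then show ?thesis using k by simp
qed

text \<open>
  A block that occupies the places \<open>a + 1, \<dots>, a + length b\<close> before the move occupies the same places
  after it, mirrored. All that is used about switches below follows from this description of them by
  positions.
\<close>

lemma block_positions:
  assumes "distinct xs" "reverses_blocks bs xs ys" "b \<in> set bs"
  obtains a where "a + length b \<le> length xs"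
    "\<And>p. p \<in> set xs \<Longrightarrow> p \<in> set b \<longleftrightarrow> a < pos xs p \<and> pos xs p \<le> a + length b"
    "\<And>p. p \<in> set xs \<Longrightarrow> p \<in> set b \<longleftrightarrow> a < pos ys p \<and> pos ys p \<le> a + length b"
    "\<And>p. p \<in> set b \<Longrightarrow> pos xs p + pos ys p = 2 * a + length b + 1"
    "centered_substring xs b \<longleftrightarrow> 2 * a + length b = length xs"
proof -
  obtain us vs where bs: "bs = us @ b # vs"
    using assms(3) by (meson split_list)
  define a where "a = length (concat us)"
  have xs: "xs = concat us @ b @ concat vs"
    and ys: "ys = concat (map rev us) @ rev b @ concat (map rev vs)"
    and ne: "b \<noteq> []"
    using assms(2) bs by (auto simp: reverses_blocks_def)
  have la: "length (concat (map rev us)) = a"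
    by (simp add: a_def length_concat comp_def)
  have seteq: "set (concat (map rev zs)) = set (concat zs)" for zs :: "'a list list"
    by auto
  have dis: "distinct b" "set (concat us) \<inter> set b = {}" "set (concat us) \<inter> set (concat vs) = {}"
      "set b \<inter> set (concat vs) = {}" "distinct (concat us)"
    using assms(1) unfolding xs by auto
  have dus: "distinct (concat (map rev us))"
    using dis(5) la by (metis a_def card_distinct distinct_card seteq)
  have inb: "pos xs p = a + pos b p" "pos ys p = a + pos (rev b) p" if "p \<in> set b" for p
    using that dis unfolding xs ys by (auto simp: pos_append a_def la[unfolded a_def] seteq simp del: set_concat)
  have out: "(pos xs p \<le> a \<and> pos ys p \<le> a) \<or> (a + length b < pos xs p \<and> a + length b < pos ys p)"
    if p: "p \<in> set xs" "p \<notin> set b" for p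
  proof (cases "p \<in> set (concat us)")
    case True
    then have "p \<in> set (concat (map rev us))" by (simp only: seteq)
    then have "pos xs p = pos (concat us) p" "pos ys p = pos (concat (map rev us)) p"
      using True unfolding xs ys by (simp_all only: pos_append if_True)
    then show ?thesis using pos_bounds[OF dis(5) True] la
        pos_bounds[OF dus \<open>p \<in> set (concat (map rev us))\<close>] by (simp add: a_def)
  next
    case False
    then have "p \<notin> set (concat (map rev us))" by (simp only: seteq not_False_eq_True)
    moreover have "pos zs p \<ge> 1" for zs by (simp add: pos_def)
    ultimately show ?thesis using p False la
      unfolding xs ys by (simp only: pos_append if_False set_rev length_rev a_def) (simp add: Suc_le_eq)
  qed
  show thesis
  proof (rule that[of a])
    show "a + length b \<le> length xs" unfolding xs by (simp add: a_def)
    show "p \<in> set b \<longleftrightarrow> a < pos xs p \<and> pos xs p \<le> a + length b" if "p \<in> set xs" for p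
      using inb[of p] out[OF that] pos_bounds[OF dis(1), of p] by fastforce
    show "p \<in> set b \<longleftrightarrow> a < pos ys p \<and> pos ys p \<le> a + length b" if "p \<in> set xs" for p
      using inb[of p] out[OF that] pos_bounds[of "rev b" p] dis(1) by fastforce
    show "pos xs p + pos ys p = 2 * a + length b + 1" if "p \<in> set b" for p
      using inb[OF that] pos_rev[OF dis(1) that] by linarith
    show "centered_substring xs b \<longleftrightarrow> 2 * a + length b = length xs"
    proof
      assume "centered_substring xs b"
      then obtain ws zs where w: "xs = ws @ b @ zs" "length ws = length zs"
        by (auto simp: centered_substring_def)
      have hb: "hd b \<in> set b" using ne by simp
      have "pos xs (hd b) = length ws + pos b (hd b)"
        using hb assms(1) unfolding w(1) by (auto simp: pos_append)
      then have "length ws = a" using inb(1)[OF hb] by simp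
      then show "2 * a + length b = length xs" using w by simp
    next
      assume "2 * a + length b = length xs"
      then have "length (concat us) = length (concat vs)"
        unfolding xs a_def by simp
      then show "centered_substring xs b" using xs unfolding centered_substring_def by blast
    qed
  qed
qed

lemma block_of:
  "reverses_blocks bs xs ys \<Longrightarrow> p \<in> set xs \<Longrightarrow> \<exists>b\<in>set bs. p \<in> set b"
  by (simp add: reverses_blocks_def)

text \<open>
  Reversing blocks acts on places as an involution: if \<open>p\<close> takes the place of \<open>q\<close>, then \<open>q\<close> takes the
  place of \<open>p\<close>.
\<close>

lemma reverses_blocks_exchange:
  assumes "distinct xs" "reverses_blocks bs xs ys" "p \<in> set xs" "q \<in> set xs"
    and "pos ys p = pos xs q"
  shows "pos ys q = pos xs p"
proof -
  obtain b where b: "b \<in> set bs" "p \<in> set b" using block_of[OF assms(2,3)] by blast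
  obtain a where a: "\<And>p. p \<in> set xs \<Longrightarrow> p \<in> set b \<longleftrightarrow> a < pos xs p \<and> pos xs p \<le> a + length b"
    "\<And>p. p \<in> set xs \<Longrightarrow> p \<in> set b \<longleftrightarrow> a < pos ys p \<and> pos ys p \<le> a + length b"
    "\<And>p. p \<in> set b \<Longrightarrow> pos xs p + pos ys p = 2 * a + length b + 1"
    using block_positions[OF assms(1,2) b(1)] by metis
  have "q \<in> set b" using a(1)[OF assms(4)] a(2)[OF assms(3)] b(2) assms(5) by simp
  then show ?thesis using a(3)[of p] a(3)[of q] b(2) assms(5) by linarith
qed

text \<open>
  Two points of one block have their order reversed. Two points of different blocks keep theirs, as
  the blocks occupy disjoint intervals of places before and after the move. So condition (iii) on
  allowable sequences says that the order of any two points changes once in a halfperiod.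
\<close>

lemma switch_iff_order_reversed:
  assumes "distinct xs" "switches xs ys \<noteq> {}" "p \<in> set xs" "q \<in> set xs" "p \<noteq> q"
  shows "(\<exists>b\<in>switches xs ys. p \<in> set b \<and> q \<in> set b) \<longleftrightarrow>
    (pos xs p < pos xs q) \<noteq> (pos ys p < pos ys q)"
proof -
  obtain bs where bs: "reverses_blocks bs xs ys"
    using assms(2) by (auto simp: switches_def)
  have ne: "pos xs p \<noteq> pos xs q" using assms pos_inj by metis
  have sw: "(\<exists>b\<in>switches xs ys. p \<in> set b \<and> q \<in> set b) \<longleftrightarrow> (\<exists>b\<in>set bs. p \<in> set b \<and> q \<in> set b)"
  proof
    assume "\<exists>b\<in>switches xs ys. p \<in> set b \<and> q \<in> set b"
    then show "\<exists>b\<in>set bs. p \<in> set b \<and> q \<in> set b"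
      using reverses_blocks_unique[OF assms(1) bs] by (auto simp: switches_def)
  next
    assume "\<exists>b\<in>set bs. p \<in> set b \<and> q \<in> set b"
    then obtain b where b: "b \<in> set bs" "p \<in> set b" "q \<in> set b" by blast
    then have "card {p, q} \<le> length b"
      by (meson card_length card_mono empty_subsetI finite_set insert_subset le_trans)
    then have "b \<in> switches xs ys" using b bs assms(5) by (auto simp: switches_def)
    then show "\<exists>b\<in>switches xs ys. p \<in> set b \<and> q \<in> set b" using b by blast
  qed
  obtain b where b: "b \<in> set bs" "p \<in> set b" using block_of[OF bs assms(3)] by blast
  obtain a where a: "\<And>p. p \<in> set xs \<Longrightarrow> p \<in> set b \<longleftrightarrow> a < pos xs p \<and> pos xs p \<le> a + length b"
    "\<And>p. p \<in> set xs \<Longrightarrow> p \<in> set b \<longleftrightarrow> a < pos ys p \<and> pos ys p \<le> a + length b"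
    "\<And>p. p \<in> set b \<Longrightarrow> pos xs p + pos ys p = 2 * a + length b + 1"
    using block_positions[OF assms(1) bs b(1)] by metis
  obtain c where c: "c \<in> set bs" "q \<in> set c" using block_of[OF bs assms(4)] by blast
  obtain a' where a': "\<And>p. p \<in> set xs \<Longrightarrow> p \<in> set c \<longleftrightarrow> a' < pos xs p \<and> pos xs p \<le> a' + length c"
    "\<And>p. p \<in> set xs \<Longrightarrow> p \<in> set c \<longleftrightarrow> a' < pos ys p \<and> pos ys p \<le> a' + length c"
    using block_positions[OF assms(1) bs c(1)] by metis
  show ?thesis
  proof (cases "q \<in> set b")
    case True
    have "pos ys p \<noteq> pos ys q" using a(3)[OF b(2)] a(3)[OF True] ne by linarith
    then have "(pos xs p < pos xs q) \<noteq> (pos ys p < pos ys q)"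
      using a(3)[OF b(2)] a(3)[OF True] ne by linarith
    moreover have "\<exists>b\<in>set bs. p \<in> set b \<and> q \<in> set b" using b True by blast
    ultimately show ?thesis unfolding sw by simp
  next
    case q: False
    have pc: "p \<notin> set c"
    proof
      assume "p \<in> set c"
      have "distinct (concat bs)" using assms(1) bs by (simp add: reverses_blocks_def)
      then have "b = c" using b c \<open>p \<in> set c\<close> by (auto simp: distinct_concat_iff)
      then show False using q c by simp
    qed
    have no: "\<not> (\<exists>b\<in>set bs. p \<in> set b \<and> q \<in> set b)"
    proof
      assume "\<exists>b\<in>set bs. p \<in> set b \<and> q \<in> set b"
      then obtain b' where b': "b' \<in> set bs" "p \<in> set b'" "q \<in> set b'" by blast
      have "distinct (concat bs)" using assms(1) bs by (simp add: reverses_blocks_def)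
      then have "b = b'" using b b' by (auto simp: distinct_concat_iff)
      then show False using q b' by simp
    qed
    have "a < pos xs p" "pos xs p \<le> a + length b" "a < pos ys p" "pos ys p \<le> a + length b"
      using a(1,2)[OF assms(3)] b(2) by blast+
    moreover have "pos xs q \<le> a \<or> a + length b < pos xs q" "pos ys q \<le> a \<or> a + length b < pos ys q"
      using a(1)[OF assms(4)] a(2)[OF assms(4)] q by linarith+
    moreover have "a' < pos xs q" "pos xs q \<le> a' + length c" "a' < pos ys q" "pos ys q \<le> a' + length c"
      using a'(1,2)[OF assms(4)] c(2) by blast+
    moreover have "pos xs p \<le> a' \<or> a' + length c < pos xs p" "pos ys p \<le> a' \<or> a' + length c < pos ys p"
      using a'(1)[OF assms(3)] a'(2)[OF assms(3)] pc by linarith+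
    ultimately have "(pos xs p < pos xs q) = (pos ys p < pos ys q)"
      by (cases "pos xs p < pos xs q") linarith+
    then show ?thesis unfolding sw using no by simp
  qed
qed

text \<open>
  Compare the first entries. If they agree, they form a block of their own. Otherwise each of them
  has to be second in the other list, since it moves by one place only, and the two form a block of
  length 2. Then continue with the rest.
\<close>

lemma adjacent_transpositions:
  assumes "length xs = length ys" "distinct xs" "distinct ys" "set xs = set ys"
    and "\<And>p. p \<in> set xs \<Longrightarrow> pos xs p \<le> pos ys p + 1 \<and> pos ys p \<le> pos xs p + 1"
  shows "\<exists>bs. reverses_blocks bs xs ys \<and> (\<forall>b\<in>set bs. length b \<le> 2)"
  using assms
proof (induction "length xs" arbitrary: xs ys rule: less_induct)
  case less
  have cons: "pos (z # zs) p = (if p = z then 1 else Suc (pos zs p))" for z p and zs :: "'a list"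
    by (simp add: pos_def)
  have pos1: "pos zs p \<ge> 1" for p and zs :: "'a list" by (simp add: pos_def)
  have hd1: "zs = p # tl zs" if "pos zs p = 1" "p \<in> set zs" for p and zs :: "'a list"
    using that by (cases zs) (simp_all add: pos_def split: if_splits)
  show ?case
  proof (cases xs)
    case Nil
    then show ?thesis using less.prems(1) by (intro exI[of _ "[]"]) (simp add: reverses_blocks_def)
  next
    case (Cons x xs')
    then obtain y ys' where ys: "ys = y # ys'" using less.prems(1) by (cases ys) auto
    show ?thesis
    proof (cases "x = y")
      case True
      have "\<exists>bs. reverses_blocks bs xs' ys' \<and> (\<forall>b\<in>set bs. length b \<le> 2)"
      proof (rule less.hyps)
        show "length xs' < length xs" "length xs' = length ys'" "distinct xs'" "distinct ys'"
          using less.prems(1,2,3) Cons ys by simp_all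
        show "set xs' = set ys'"
          using less.prems(2,3,4) Cons ys True by (simp add: insert_ident)
        fix p assume p: "p \<in> set xs'"
        then have "p \<noteq> x" using less.prems(2) Cons by auto
        then show "pos xs' p \<le> pos ys' p + 1 \<and> pos ys' p \<le> pos xs' p + 1"
          using less.prems(5)[of p] p Cons ys True by (simp add: cons)
      qed
      then obtain bs where "reverses_blocks bs xs' ys'" "\<forall>b\<in>set bs. length b \<le> 2" by blast
      then show ?thesis using Cons ys True
        by (intro exI[of _ "[x] # bs"]) (auto simp: reverses_blocks_def)
    next
      case False
      have "x \<in> set ys" unfolding less.prems(4)[symmetric] Cons by simp
      then have x: "x \<in> set ys'" using ys False by simp
      have "y \<in> set xs" unfolding less.prems(4) ys by simp
      then have y: "y \<in> set xs'" using Cons False by simp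
      have "pos ys' x = 1" using less.prems(5)[of x] Cons ys False pos1[of ys' x] by (simp add: cons)
      then obtain ys'' where ys'': "ys' = x # ys''" using hd1 x by blast
      have "pos xs' y = 1" using less.prems(5)[of y] Cons ys y False pos1[of xs' y] by (simp add: cons)
      then obtain xs'' where xs'': "xs' = y # xs''" using hd1 y by blast
      have "\<exists>bs. reverses_blocks bs xs'' ys'' \<and> (\<forall>b\<in>set bs. length b \<le> 2)"
      proof (rule less.hyps)
        show "length xs'' < length xs" "length xs'' = length ys''" "distinct xs''" "distinct ys''"
          using less.prems(1,2,3) Cons ys xs'' ys'' by simp_all
        show "set xs'' = set ys''"
        proof -
          have "insert x (insert y (set xs'')) = insert x (insert y (set ys''))"
            using less.prems(4) Cons ys xs'' ys'' by (simp add: insert_commute)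
          moreover have "x \<notin> insert y (set xs'')" "x \<notin> insert y (set ys'')" "y \<notin> set xs''" "y \<notin> set ys''"
            using less.prems(2,3) Cons ys xs'' ys'' by auto
          ultimately show ?thesis by (metis insert_ident)
        qed
        fix p assume p: "p \<in> set xs''"
        then have "p \<noteq> x" "p \<noteq> y" using less.prems(2) Cons xs'' by auto
        then show "pos xs'' p \<le> pos ys'' p + 1 \<and> pos ys'' p \<le> pos xs'' p + 1"
          using less.prems(5)[of p] p Cons ys xs'' ys'' by (simp add: cons)
      qed
      then obtain bs where "reverses_blocks bs xs'' ys''" "\<forall>b\<in>set bs. length b \<le> 2" by blast
      then show ?thesis using Cons ys xs'' ys''
        by (intro exI[of _ "[x, y] # bs"]) (auto simp: reverses_blocks_def)
    qed
  qed
qed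

section \<open>Moves described by signed positions\<close>

text \<open>
  Leaving out height 0 makes the reflection about the centre of a list of length \<open>2 n\<close> the negation.
\<close>

definition signed_pos :: "nat \<Rightarrow> 'a list \<Rightarrow> 'a \<Rightarrow> int"
  where "signed_pos n xs p =
    (if n < pos xs p then int (pos xs p) - int n else int (pos xs p) - int n - 1)"

lemma signed_pos_less: "signed_pos n xs p < signed_pos n xs q \<longleftrightarrow> pos xs p < pos xs q"
  by (auto simp: signed_pos_def)

lemma pos_eq_signed: "int (pos xs p) =
    (if 0 < signed_pos n xs p then signed_pos n xs p + int n else signed_pos n xs p + int n + 1)"
  by (auto simp: signed_pos_def)

lemma signed_pos_bounds:
  "distinct xs \<Longrightarrow> length xs = 2 * n \<Longrightarrow> p \<in> set xs \<Longrightarrow> signed_pos n xs p \<in> {- int n..int n} - {0}"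
  using pos_bounds[of xs p] by (auto simp: signed_pos_def)

lemma signed_pos_opposite: "signed_pos n xs p = - signed_pos n ys q \<Longrightarrow> pos xs p + pos ys q = 2 * n + 1"
  by (auto simp: signed_pos_def split: if_splits)

lemma signed_pos_inj:
  "distinct xs \<Longrightarrow> p \<in> set xs \<Longrightarrow> q \<in> set xs \<Longrightarrow> signed_pos n xs p = signed_pos n xs q \<Longrightarrow> p = q"
  by (metis pos_inj nat_int pos_eq_signed)

lemma crossing_switch_pos:
  assumes "distinct xs" "b \<in> crossing_switches xs ys" "p \<in> set b"
  shows "pos xs p + pos ys p = length xs + 1"
proof -
  obtain bs where bs: "reverses_blocks bs xs ys" "b \<in> set bs" "centered_substring xs b"
    using assms(2) by (auto simp: crossing_switches_def switches_def)
  obtain a where a: "\<And>p. p \<in> set b \<Longrightarrow> pos xs p + pos ys p = 2 * a + length b + 1"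
    "centered_substring xs b \<longleftrightarrow> 2 * a + length b = length xs"
    using block_positions[OF assms(1) bs(1,2)] by metis
  then show ?thesis using bs(3) assms(3) by simp
qed

text \<open>
  The hypotheses separate the places left of the centred substring, inside it and right of it; the
  outer parts are handled by \<open>adjacent_transpositions\<close>.
\<close>

lemma central_move_blocks:
  fixes xs ys :: "'a list"
  assumes dist: "distinct xs" "distinct ys" and same: "set xs = set ys"
    and len: "length xs = 2 * n" and e: "e \<le> n"
    and central: "\<And>p. p \<in> set xs \<Longrightarrow> n - e < pos xs p \<Longrightarrow> pos xs p \<le> n + e \<Longrightarrow> pos xs p + pos ys p = 2 * n + 1"
    and left: "\<And>p. p \<in> set xs \<Longrightarrow> pos xs p \<le> n - e \<Longrightarrow>
      pos ys p \<le> n - e \<and> pos xs p \<le> pos ys p + 1 \<and> pos ys p \<le> pos xs p + 1"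
    and right: "\<And>p. p \<in> set xs \<Longrightarrow> n + e < pos xs p \<Longrightarrow>
      n + e < pos ys p \<and> pos xs p \<le> pos ys p + 1 \<and> pos ys p \<le> pos xs p + 1"
  shows "\<exists>as M cs. reverses_blocks (as @ (if e = 0 then [] else [M]) @ cs) xs ys \<and>
    (\<forall>b\<in>set as \<union> set cs. length b \<le> 2) \<and> length M = 2 * e \<and> centered_substring xs M"
proof -
  define A where "A = take (n - e) xs"
  define M where "M = take (2 * e) (drop (n - e) xs)"
  define B where "B = drop (n + e) xs"
  define A' where "A' = take (n - e) ys"
  define M' where "M' = take (2 * e) (drop (n - e) ys)"
  define B' where "B' = drop (n + e) ys"
  have leny: "length ys = 2 * n" using dist same len by (metis distinct_card)
  have split: "zs = take (n - e) zs @ take (2 * e) (drop (n - e) zs) @ drop (n + e) zs"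
    if "length zs = 2 * n" for zs :: "'a list"
  proof -
    have "drop (n + e) zs = drop (2 * e) (drop (n - e) zs)" using e by (simp add: drop_drop add.commute)
    then show ?thesis by (simp only: append_take_drop_id)
  qed
  have xs: "xs = A @ M @ B" and ys: "ys = A' @ M' @ B'"
    using split[OF len] split[OF leny] by (simp_all add: A_def M_def B_def A'_def M'_def B'_def)
  have l: "length A = n - e" "length M = 2 * e" "length B = n - e"
    "length A' = n - e" "length M' = 2 * e" "length B' = n - e"
    using e by (simp_all add: A_def M_def B_def A'_def M'_def B'_def len leny)
  have dx: "distinct A" "distinct M" "distinct B" "set A \<inter> set M = {}" "set A \<inter> set B = {}" "set M \<inter> set B = {}"
    using dist(1) unfolding xs by auto
  have dy: "distinct A'" "distinct M'" "distinct B'" "set A' \<inter> set M' = {}" "set A' \<inter> set B' = {}" "set M' \<inter> set B' = {}"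
    using dist(2) unfolding ys by auto
  have pA: "pos xs p = pos A p" if "p \<in> set A" for p using that unfolding xs by (simp add: pos_append)
  have pB: "pos xs p = n + e + pos B p" if "p \<in> set B" for p
    using that dx e unfolding xs by (auto simp: pos_append l)
  have pA': "pos ys p = pos A' p" if "p \<in> set A'" for p using that unfolding ys by (simp add: pos_append)
  have pB': "pos ys p = n + e + pos B' p" if "p \<in> set B'" for p
    using that dy e unfolding ys by (auto simp: pos_append l)
  have pM: "pos xs p = n - e + pos M p" if "p \<in> set M" for p
    using that dx unfolding xs by (auto simp: pos_append l)
  have pM': "pos ys p = n - e + pos M' p" if "p \<in> set M'" for p
    using that dy unfolding ys by (auto simp: pos_append l)
  have inxs: "p \<in> set xs \<longleftrightarrow> p \<in> set A \<or> p \<in> set M \<or> p \<in> set B" for p unfolding xs by simp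
  have inys: "p \<in> set xs \<longleftrightarrow> p \<in> set A' \<or> p \<in> set M' \<or> p \<in> set B'" for p unfolding same ys by simp
  have bd: "1 \<le> pos zs p \<and> pos zs p \<le> length zs" if "distinct zs" "p \<in> set zs" for zs and p :: 'a
    using pos_bounds that by metis
  have AA': "set A = set A'"
  proof -
    have "set A \<subseteq> set A'"
    proof
      fix p assume p: "p \<in> set A"
      then have "pos xs p \<le> n - e" using pA bd[OF dx(1) p] l by simp
      then have "pos ys p \<le> n - e" using left p inxs by blast
      moreover have "\<not> pos ys p \<le> n - e" if "p \<in> set M'" using pM'[OF that] bd[OF dy(2) that] by simp
      moreover have "\<not> pos ys p \<le> n - e" if "p \<in> set B'" using pB'[OF that] bd[OF dy(3) that] by linarith
      ultimately show "p \<in> set A'" using p inxs inys by blast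
    qed
    then show ?thesis using dx(1) dy(1) l by (intro card_subset_eq) (simp_all add: distinct_card)
  qed
  have BB': "set B = set B'"
  proof -
    have "set B \<subseteq> set B'"
    proof
      fix p assume p: "p \<in> set B"
      then have "n + e < pos xs p" using pB bd[OF dx(3) p] l by simp
      then have "n + e < pos ys p" using right p inxs by blast
      moreover have "\<not> n + e < pos ys p" if "p \<in> set M'" using pM'[OF that] bd[OF dy(2) that] l e by linarith
      moreover have "\<not> n + e < pos ys p" if "p \<in> set A'" using pA'[OF that] bd[OF dy(1) that] l e by linarith
      ultimately show "p \<in> set B'" using p inxs inys by blast
    qed
    then show ?thesis using dx(3) dy(3) l by (intro card_subset_eq) (simp_all add: distinct_card)
  qed
  have MM': "set M = set M'"
  proof -
    have "set xs = set A \<union> set M \<union> set B" "set xs = set A' \<union> set M' \<union> set B'"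
      using inxs inys by blast+
    then have "set M = set xs - set A - set B" "set M' = set xs - set A' - set B'"
      using dx(4,6) dy(4,6) by auto
    then show ?thesis using AA' BB' by simp
  qed
  have "\<exists>as. reverses_blocks as A A' \<and> (\<forall>b\<in>set as. length b \<le> 2)"
  proof (rule adjacent_transpositions)
    fix p assume p: "p \<in> set A"
    then have "pos xs p \<le> n - e" using pA bd[OF dx(1) p] l by simp
    then have "pos xs p \<le> pos ys p + 1 \<and> pos ys p \<le> pos xs p + 1" using left p inxs by blast
    then show "pos A p \<le> pos A' p + 1 \<and> pos A' p \<le> pos A p + 1" using pA pA' p AA' by simp
  qed (use l dx dy AA' in auto)
  then obtain as where as: "reverses_blocks as A A'" "\<forall>b\<in>set as. length b \<le> 2" by blast
  have "\<exists>cs. reverses_blocks cs B B' \<and> (\<forall>b\<in>set cs. length b \<le> 2)"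
  proof (rule adjacent_transpositions)
    fix p assume p: "p \<in> set B"
    then have "n + e < pos xs p" using pB bd[OF dx(3) p] l by simp
    then have "pos xs p \<le> pos ys p + 1 \<and> pos ys p \<le> pos xs p + 1" using right p inxs by blast
    then show "pos B p \<le> pos B' p + 1 \<and> pos B' p \<le> pos B p + 1" using pB pB' p BB' by simp
  qed (use l dx dy BB' in auto)
  then obtain cs where cs: "reverses_blocks cs B B'" "\<forall>b\<in>set cs. length b \<le> 2" by blast
  have rM: "M' = rev M"
  proof (rule nth_equalityI)
    fix i assume i: "i < length M'"
    define p where "p = M' ! i"
    have p: "p \<in> set M'" "p \<in> set M" using i MM' by (auto simp: p_def)
    have "pos M' p = Suc i" unfolding p_def using pos_nth[OF dy(2) i] .
    moreover have "pos xs p + pos ys p = 2 * n + 1"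
      using pM[OF p(2)] bd[OF dx(2) p(2)] l e p inxs by (intro central) auto
    ultimately have "pos M p = 2 * e - i"
      using pM[OF p(2)] pM'[OF p(1)] e i l by linarith
    then have "M ! (2 * e - i - 1) = p" using nth_pos[OF dx(2) p(2)] by simp
    then show "M' ! i = rev M ! i" using i l by (simp add: rev_nth p_def)
  qed (simp add: l)
  have M0: "M = []" if "e = 0" using l that by simp
  have "reverses_blocks (as @ (if e = 0 then [] else [M]) @ cs) xs ys"
    using as(1) cs(1) rM M0 l unfolding reverses_blocks_def xs ys by auto
  moreover have "centered_substring xs M"
    using xs l unfolding centered_substring_def by metis
  ultimately show ?thesis using as(2) cs(2) l by blast
qed

text \<open>
  The form in which moves are recognised from prescribed heights: \<open>e\<close> becomes half the number of
  points in the crossing switch, with \<open>e = 0\<close> if there is none. The last hypothesis excludes a move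
  without any switch.
\<close>

lemma central_move:
  fixes xs ys :: "'a list"
  assumes dist: "distinct xs" "distinct ys" and same: "set xs = set ys"
    and len: "length xs = 2 * n" and e: "0 \<le> e" "e \<le> int n"
    and inner: "\<And>p. p \<in> set xs \<Longrightarrow> \<bar>signed_pos n xs p\<bar> \<le> e \<Longrightarrow> signed_pos n ys p = - signed_pos n xs p"
    and outer: "\<And>p. p \<in> set xs \<Longrightarrow> e < \<bar>signed_pos n xs p\<bar> \<Longrightarrow>
      \<bar>signed_pos n ys p - signed_pos n xs p\<bar> \<le> 1 \<and>
      (0 < signed_pos n ys p \<longleftrightarrow> 0 < signed_pos n xs p) \<and> e < \<bar>signed_pos n ys p\<bar>"
    and moves: "e = 0 \<Longrightarrow> \<exists>p\<in>set xs. signed_pos n xs p \<noteq> signed_pos n ys p"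
  shows "switches xs ys \<noteq> {}"
    and "\<forall>b \<in> switches xs ys - crossing_switches xs ys. length b = 2"
    and "crossing_switches xs ys = {} \<longleftrightarrow> e = 0"
    and "e \<noteq> 0 \<Longrightarrow> int (length (the_elem (crossing_switches xs ys)) div 2) = e"
proof -
  define k where "k = nat e"
  have ek: "e = int k" "k \<le> n" using e by (simp_all add: k_def)
  have "\<exists>as M cs. reverses_blocks (as @ (if k = 0 then [] else [M]) @ cs) xs ys \<and>
    (\<forall>b\<in>set as \<union> set cs. length b \<le> 2) \<and> length M = 2 * k \<and> centered_substring xs M"
  proof (rule central_move_blocks[OF dist same len ek(2)])
    fix p assume p: "p \<in> set xs"
    note P = pos_bounds[OF dist(1) p] pos_bounds[OF dist(2) p[unfolded same]]
    show "pos xs p + pos ys p = 2 * n + 1" if "n - k < pos xs p" "pos xs p \<le> n + k"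
    proof -
      have "\<bar>signed_pos n xs p\<bar> \<le> e" using that ek by (auto simp: signed_pos_def)
      then have "signed_pos n xs p = - signed_pos n ys p" using inner p by simp
      then show ?thesis by (rule signed_pos_opposite)
    qed
    show "pos ys p \<le> n - k \<and> pos xs p \<le> pos ys p + 1 \<and> pos ys p \<le> pos xs p + 1" if "pos xs p \<le> n - k"
    proof -
      have "e < \<bar>signed_pos n xs p\<bar>" using that ek P by (auto simp: signed_pos_def)
      from outer[OF p this] show ?thesis using that ek
        by (auto simp: signed_pos_def split: if_splits)
    qed
    show "n + k < pos ys p \<and> pos xs p \<le> pos ys p + 1 \<and> pos ys p \<le> pos xs p + 1" if "n + k < pos xs p"
    proof -
      have "e < \<bar>signed_pos n xs p\<bar>" using that ek P by (auto simp: signed_pos_def)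
      from outer[OF p this] show ?thesis using that ek
        by (auto simp: signed_pos_def split: if_splits)
    qed
  qed
  then obtain as M cs where rb: "reverses_blocks (as @ (if k = 0 then [] else [M]) @ cs) xs ys"
    and short: "\<forall>b\<in>set as \<union> set cs. length b \<le> 2" and M: "length M = 2 * k" "centered_substring xs M"
    by blast
  let ?bs = "as @ (if k = 0 then [] else [M]) @ cs"
  have sw: "switches xs ys = {b \<in> set ?bs. 2 \<le> length b}"
    using rb reverses_blocks_unique[OF dist(1) rb] unfolding switches_def by blast
  have Mcr: "M \<in> crossing_switches xs ys" if "k \<noteq> 0"
    using that M unfolding crossing_switches_def sw by auto
  have none: "crossing_switches xs ys = {}" if "k = 0"
  proof (rule ccontr)
    assume "crossing_switches xs ys \<noteq> {}"
    then obtain b where b: "b \<in> crossing_switches xs ys" by blast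
    then have "b \<noteq> []" "b \<in> set ?bs" by (auto simp: crossing_switches_def sw)
    then obtain p where p: "p \<in> set b" by (cases b) auto
    have "xs = concat ?bs" using rb by (simp add: reverses_blocks_def)
    moreover have "p \<in> set (concat ?bs)" using p \<open>b \<in> set ?bs\<close> by auto
    ultimately have px: "p \<in> set xs" by simp
    have "pos xs p + pos ys p = 2 * n + 1" using crossing_switch_pos[OF dist(1) b p] len by simp
    moreover have "e < \<bar>signed_pos n xs p\<bar>" using signed_pos_bounds[OF dist(1) len px] that ek by auto
    ultimately show False using outer[OF px] by (auto simp: signed_pos_def split: if_splits)
  qed
  have cr: "crossing_switches xs ys = {M}" if "k \<noteq> 0"
    using Mcr[OF that] crossing_switches_unique[OF dist(1) Mcr[OF that]] by blast
  show "crossing_switches xs ys = {} \<longleftrightarrow> e = 0" using cr none ek by (cases "k = 0") auto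
  show "int (length (the_elem (crossing_switches xs ys)) div 2) = e" if "e \<noteq> 0"
    using that cr ek M by simp
  show "\<forall>b \<in> switches xs ys - crossing_switches xs ys. length b = 2"
  proof
    fix b assume b: "b \<in> switches xs ys - crossing_switches xs ys"
    then have "b \<noteq> M \<or> k = 0" using Mcr by blast
    then have "b \<in> set as \<union> set cs" "2 \<le> length b" using b unfolding sw by (auto split: if_splits)
    then show "length b = 2" using short by (intro le_antisym) blast+
  qed
  show "switches xs ys \<noteq> {}"
  proof (cases "k = 0")
    case True
    obtain p where p: "p \<in> set xs" "signed_pos n xs p \<noteq> signed_pos n ys p" using moves ek True by auto
    obtain b where b: "b \<in> set ?bs" "p \<in> set b" using block_of[OF rb p(1)] by blast
    have "\<not> length b \<le> 1"
    proof
      assume "length b \<le> 1"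
      then have "length b = 1" using b(2) by (cases b) auto
      then obtain a where "\<And>q. q \<in> set xs \<Longrightarrow> q \<in> set b \<longleftrightarrow> a < pos xs q \<and> pos xs q \<le> a + 1"
        "\<And>q. q \<in> set xs \<Longrightarrow> q \<in> set b \<longleftrightarrow> a < pos ys q \<and> pos ys q \<le> a + 1"
        using block_positions[OF dist(1) rb b(1)] by metis
      then have eq: "pos xs p = pos ys p" using p(1) b(2) by (metis add_diff_cancel_right' le_antisym not_less_eq_eq Suc_eq_plus1 not_le)
      have "signed_pos n xs p = signed_pos n ys p" unfolding signed_pos_def eq ..
      then show False using p(2) by simp
    qed
    then show ?thesis using b(1) unfolding sw by fastforce
  next
    case False
    then show ?thesis using Mcr by (auto simp: crossing_switches_def)
  qed
qed

section \<open>Periodic predicates on the integers\<close>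

lemma periodic_shift:
  fixes P :: "int \<Rightarrow> 'b"
  assumes "\<And>i. P (i + h) = P i"
  shows "P (i + h * k) = P i"
proof -
  have nat: "P (i + h * int m) = P i" for i m
  proof (induction m)
    case (Suc m)
    then show ?case using assms[of "i + h * int m"] by (simp add: algebra_simps)
  qed simp
  show ?thesis
  proof (cases "0 \<le> k")
    case True
    then show ?thesis using nat[of i "nat k"] by simp
  next
    case False
    then show ?thesis using nat[of "i + h * k" "nat (- k)"] by simp
  qed
qed

text \<open>
  The right-hand side does not mention the window, so uniqueness can be carried from any window of
  length \<open>h\<close> to any other.
\<close>

lemma periodic_unique_iff:
  fixes P :: "int \<Rightarrow> bool"
  assumes "0 < h" "\<And>i. P (i + h) = P i"
  shows "(\<exists>!i. i \<in> {a + 1..a + h} \<and> P i) \<longleftrightarrow> (\<exists>x. \<forall>i. P i \<longleftrightarrow> h dvd i - x)"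
proof -
  define r where "r x = a + 1 + (x - a - 1) mod h" for x
  have r: "r x \<in> {a + 1..a + h}" "h dvd x - r x" for x
  proof -
    have "0 \<le> (x - a - 1) mod h" "(x - a - 1) mod h < h" using assms(1) by simp_all
    then show "r x \<in> {a + 1..a + h}" unfolding r_def atLeastAtMost_iff by linarith
    have "x - r x = (x - a - 1) - (x - a - 1) mod h" by (simp add: r_def)
    then show "h dvd x - r x" by (simp only: dvd_minus_mod)
  qed
  have cong: "P i \<longleftrightarrow> P j" if "h dvd i - j" for i j
  proof -
    from that obtain k where "i = j + h * k" by (metis dvd_def diff_eq_eq add.commute)
    then show ?thesis using periodic_shift[of P h, OF assms(2)] by simp
  qed
  have window: "i = j" if "i \<in> {a + 1..a + h}" "j \<in> {a + 1..a + h}" "h dvd i - j" for i j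
  proof (rule ccontr)
    assume "i \<noteq> j"
    then have "h \<le> \<bar>i - j\<bar>" using that(3) dvd_imp_le_int[of "i - j" h] assms(1) by simp
    then show False using that(1,2) by auto
  qed
  show ?thesis
  proof
    assume "\<exists>!i. i \<in> {a + 1..a + h} \<and> P i"
    then obtain x where x: "x \<in> {a + 1..a + h}" "P x"
      and un: "\<And>i. i \<in> {a + 1..a + h} \<Longrightarrow> P i \<Longrightarrow> i = x" by blast
    have "P i \<longleftrightarrow> h dvd i - x" for i
    proof
      assume "P i"
      then have "P (r i)" using cong r(2) by blast
      then have "r i = x" using un r(1) by blast
      then show "h dvd i - x" using r(2)[of i] by simp
    next
      assume "h dvd i - x"
      then show "P i" using cong x(2) by blast
    qed
    then show "\<exists>x. \<forall>i. P i \<longleftrightarrow> h dvd i - x" by blast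
  next
    assume "\<exists>x. \<forall>i. P i \<longleftrightarrow> h dvd i - x"
    then obtain x where x: "\<And>i. P i \<longleftrightarrow> h dvd i - x" by blast
    show "\<exists>!i. i \<in> {a + 1..a + h} \<and> P i"
    proof (rule ex1I[of _ "r x"])
      have "h dvd r x - x" using r(2)[of x] by (simp add: dvd_diff_commute)
      then show "r x \<in> {a + 1..a + h} \<and> P (r x)" using r(1) x by simp
      fix i assume i: "i \<in> {a + 1..a + h} \<and> P i"
      then have "h dvd (i - x) + (x - r x)" using x r(2) by (blast intro: dvd_add)
      then show "i = r x" using window i r(1) by simp
    qed
  qed
qed

text \<open>
  As \<open>B\<close> takes opposite values at the ends of the window and cannot become false in it, it becomes
  true there exactly once; the change recurs with period \<open>h\<close>.
\<close>

lemma monotone_window_changes_once: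
  fixes B :: "int \<Rightarrow> bool"
  assumes h: "0 < h" and anti: "\<And>T. B (T + h) \<longleftrightarrow> \<not> B T"
    and mono: "\<And>T. T0 \<le> T \<Longrightarrow> T < T0 + h \<Longrightarrow> B T \<Longrightarrow> B (T + 1)"
  shows "\<exists>!i. i \<in> {1..h} \<and> B (i - 1) \<noteq> B i"
proof -
  have per: "(B (i + h - 1) \<noteq> B (i + h)) = (B (i - 1) \<noteq> B i)" for i
    using anti[of "i - 1"] anti[of i] by (simp add: algebra_simps)
  have up: "T \<le> T' \<Longrightarrow> T' \<le> T0 + h \<Longrightarrow> T0 \<le> T \<Longrightarrow> B T \<Longrightarrow> B T'" for T T'
  proof (induction T' rule: int_ge_induct)
    case (step i)
    then show ?case using mono[of i] by simp
  qed simp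
  have b0: "\<not> B T0" using up[of T0 "T0 + h"] anti[of T0] h by auto
  then have bh: "B (T0 + h)" using anti by simp
  define k where "k = (LEAST k. B (T0 + int k))"
  have ex: "B (T0 + int (nat h))" using bh h by simp
  have k: "B (T0 + int k)" unfolding k_def by (rule LeastI) (rule ex)
  have less: "\<not> B (T0 + int l)" if "l < k" for l using that unfolding k_def by (rule not_less_Least)
  have kh: "int k \<le> h" using Least_le[of "\<lambda>k. B (T0 + int k)", OF ex] h unfolding k_def by linarith
  have k0: "0 < k" using k b0 by (cases k) auto
  have "\<exists>!i. i \<in> {T0 + 1..T0 + h} \<and> B (i - 1) \<noteq> B i"
  proof (rule ex1I[of _ "T0 + int k"])
    show "T0 + int k \<in> {T0 + 1..T0 + h} \<and> B (T0 + int k - 1) \<noteq> B (T0 + int k)"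
      using k k0 kh less[of "k - 1"] by (auto simp: of_nat_diff algebra_simps)
    fix i assume i: "i \<in> {T0 + 1..T0 + h} \<and> B (i - 1) \<noteq> B i"
    show "i = T0 + int k"
    proof (rule ccontr)
      assume "i \<noteq> T0 + int k"
      then consider "i < T0 + int k" | "T0 + int k \<le> i - 1" by linarith
      then show False
      proof cases
        case 1
        then have "nat (i - T0) < k" "nat (i - 1 - T0) < k" using i k0 by auto
        then have "\<not> B i" "\<not> B (i - 1)"
          using less[of "nat (i - T0)"] less[of "nat (i - 1 - T0)"] i by auto
        then show False using i by simp
      next
        case 2
        then have "B i" "B (i - 1)"
          using up[of "T0 + int k" i] up[of "T0 + int k" "i - 1"] i k by auto
        then show False using i by simp
      qed
    qed
  qed
  then have "\<exists>x. \<forall>i. (B (i - 1) \<noteq> B i) \<longleftrightarrow> h dvd i - x"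
    using periodic_unique_iff[of h "\<lambda>i. B (i - 1) \<noteq> B i" T0] h per by simp
  then show ?thesis
    using periodic_unique_iff[of h "\<lambda>i. B (i - 1) \<noteq> B i" 0] h per by simp
qed

section \<open>Height profiles\<close>

text \<open>
  The height, \<open>s\<close> moves after the crossing switch, of the point that leaves a crossing switch of
  \<open>2 d\<close> points at height \<open>j\<close>. It waits until the \<open>d - j\<close> points above it have left, rises by one in
  each move, and rests when its block fills the top \<open>d\<close> places. As the next crossing of the point is
  the move number \<open>2 n\<close>, the way back is the mirror image under \<open>s \<mapsto> 2 n - 1 - s\<close>.
\<close>

definition profile :: "int \<Rightarrow> int \<Rightarrow> int \<Rightarrow> int \<Rightarrow> int"
  where "profile n d j s = min (n - d + j) (max j (2 * j - d + min s (2 * n - 1 - s)))"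

text \<open>
  The point enters the positive side at time \<open>C\<close>, and changes sides every \<open>2 n\<close> moves.
\<close>

definition height :: "int \<Rightarrow> int \<Rightarrow> int \<Rightarrow> int \<Rightarrow> int \<Rightarrow> int"
  where "height n C d j T =
    (if even ((T - C) div (2 * n)) then 1 else - 1) * profile n d j ((T - C) mod (2 * n))"

text \<open>
  Two blocks, of \<open>d\<close> and \<open>d'\<close> points, crossing at \<open>C\<close> and \<open>C'\<close>: the lower bound is the time they need
  to exchange places near the centre, the upper bound is the same condition for \<open>C'\<close> and \<open>C + 2 n\<close>.
  The parity makes a rising and a falling point meet at neighbouring places, which they can exchange,
  and not at a common place.
\<close>

definition separated :: "int \<Rightarrow> int \<Rightarrow> int \<Rightarrow> int \<Rightarrow> int \<Rightarrow> bool"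
  where "separated n C d C' d' \<longleftrightarrow>
    d + d' \<le> C' - C \<and> C' - C \<le> 2 * n - d - d' \<and> even (C' - C - d - d')"

lemma profile_bounds: "1 \<le> j \<Longrightarrow> j \<le> d \<Longrightarrow> d \<le> n \<Longrightarrow> 1 \<le> profile n d j s \<and> profile n d j s \<le> n"
  by (auto simp: profile_def)

lemma profile_less: "j < j' \<Longrightarrow> profile n d j s < profile n d j' s"
  by (auto simp: profile_def min_def max_def)

lemma profile_diff: "\<bar>profile n d j (s + 1) - profile n d j s\<bar> \<le> 1"
  by (auto simp: profile_def min_def max_def)

lemma profile_increase: "profile n d j s < profile n d j (s + 1) \<Longrightarrow> s < n - 1"
  by (auto simp: profile_def min_def max_def split: if_splits)

lemma profile_decrease: "profile n d j (s + 1) < profile n d j s \<Longrightarrow> n - 1 < s"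
  by (auto simp: profile_def min_def max_def split: if_splits)

lemma profile_ends: "1 \<le> j \<Longrightarrow> j \<le> d \<Longrightarrow> d \<le> n \<Longrightarrow> profile n d j 0 = j \<and> profile n d j (2 * n - 1) = j"
  by (auto simp: profile_def)

text \<open>
  Some point of a block moves at each step \<open>s\<close>, except at the crossing and at the turning point
  \<open>s = n\<close>. The witness is the lowest point of the block that has begun to move.
\<close>

lemma profile_moves:
  assumes "1 \<le> d" "d < n" "1 \<le> s" "s < 2 * n" "s \<noteq> n"
  shows "\<exists>j. 1 \<le> j \<and> j \<le> d \<and> profile n d j (s - 1) \<noteq> profile n d j s"
proof -
  \<comment> \<open>Steps \<open>s\<close> and \<open>2 n - s\<close> are mirror images of each other, so \<open>v\<close> reduces to the rising half.\<close>
  define v where "v = min s (2 * n - s)"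
  have "profile n d (max 1 (d - v + 1)) (s - 1) \<noteq> profile n d (max 1 (d - v + 1)) s"
    using assms by (auto simp: profile_def v_def min_def max_def)
  then show ?thesis using assms by (intro exI[of _ "max 1 (d - v + 1)"]) (auto simp: v_def)
qed

text \<open>
  With \<open>C' - C - d - d' = 2 k\<close> this is linear arithmetic in each case of the minima and maxima. Parity
  decides the case that one point rises and the other falls; in the remaining cases the points are
  too far apart.
\<close>

lemma profile_neq:
  assumes "1 \<le> j" "j \<le> d" "1 \<le> j'" "j' \<le> d'" "0 \<le> s'" "s < 2 * n"
    and "separated n C d C' d'" "s - s' = C' - C"
  shows "profile n d j s \<noteq> profile n d' j' s'"
proof
  assume eq: "profile n d j s = profile n d' j' s'"
  have "even (C' - C - d - d')" using assms(7) by (simp only: separated_def)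
  then obtain k where k: "C' - C - d - d' = 2 * k" by (rule evenE)
  have D: "s = s' + d + d' + 2 * k" "0 \<le> k" "2 * d + 2 * d' + 2 * k \<le> 2 * n"
    using assms(7,8) k by (auto simp: separated_def)
  show False using eq assms(1-6) D(2,3) unfolding profile_def D(1) min_def max_def
    by (simp split: if_splits) presburger+
qed

lemma height_antiperiodic:
  assumes "0 < n"
  shows "height n C d j (T + 2 * n) = - height n C d j T"
    and "height n (C + 2 * n) d j T = - height n C d j T"
proof -
  have *: "(x + 2 * n) div (2 * n) = x div (2 * n) + 1" "(x + 2 * n) mod (2 * n) = x mod (2 * n)"
    "(x - 2 * n) div (2 * n) = x div (2 * n) - 1" "(x - 2 * n) mod (2 * n) = x mod (2 * n)" for x
    using assms div_add_self2[of "2 * n" x] div_add_self2[of "2 * n" "x - 2 * n"]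
    by (simp_all add: minus_mod_self2)
  have e: "T + 2 * n - C = (T - C) + 2 * n" "T - (C + 2 * n) = (T - C) - 2 * n" by simp_all
  show "height n C d j (T + 2 * n) = - height n C d j T"
    "height n (C + 2 * n) d j T = - height n C d j T"
    unfolding height_def e * by simp_all
qed

lemma height_eq_profile:
  "0 < n \<Longrightarrow> C \<le> T \<Longrightarrow> T < C + 2 * n \<Longrightarrow> height n C d j T = profile n d j (T - C)"
  by (simp add: height_def div_pos_pos_trivial mod_pos_pos_trivial)

lemma height_eq_minus_profile:
  assumes "0 < n" "C + 2 * n \<le> T" "T < C + 4 * n"
  shows "height n C d j T = - profile n d j (T - C - 2 * n)"
proof -
  have "height n C d j T = - height n C d j (T - 2 * n)"
    using height_antiperiodic(1)[OF assms(1), of C d j "T - 2 * n"] by simp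
  then show ?thesis using height_eq_profile[of n C "T - 2 * n"] assms by (simp add: algebra_simps)
qed

lemma abs_height: "1 \<le> j \<Longrightarrow> j \<le> d \<Longrightarrow> d \<le> n \<Longrightarrow>
    \<bar>height n C d j T\<bar> = profile n d j ((T - C) mod (2 * n))"
  using profile_bounds[of j d n "(T - C) mod (2 * n)"] by (simp add: height_def)

lemma abs_height_neq:
  assumes "1 \<le> j" "j \<le> d" "1 \<le> j'" "j' \<le> d'" "separated n C d C' d'"
  shows "\<bar>height n C d j T\<bar> \<noteq> \<bar>height n C' d' j' T\<bar>"
proof -
  let ?D = "C' - C"
  have D: "0 < ?D" "?D < 2 * n" "d \<le> n" "d' \<le> n" and n: "0 < n"
    using assms by (auto simp: separated_def)
  define s where "s = (T - C) mod (2 * n)"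
  define s' where "s' = (T - C') mod (2 * n)"
  have s: "0 \<le> s" "s < 2 * n" "0 \<le> s'" "s' < 2 * n"
    using n by (simp_all add: s_def s'_def)
  have ss: "s' = (s - ?D) mod (2 * n)" unfolding s_def s'_def by (simp add: mod_simps)
  have c: "s' = s - ?D \<or> s' = s - ?D + 2 * n"
  proof (cases "?D \<le> s")
    case False
    have "(s - ?D) mod (2 * n) = (s - ?D + 2 * n) mod (2 * n)" by simp
    also have "\<dots> = s - ?D + 2 * n" using s D False by (intro mod_pos_pos_trivial) auto
    finally show ?thesis using ss by simp
  qed (use ss s D in \<open>simp add: mod_pos_pos_trivial\<close>)
  have "profile n d j s \<noteq> profile n d' j' s'" using c
  proof
    assume "s' = s - ?D"
    then show ?thesis using profile_neq[of j d j' d' s' s n C C'] assms s by simp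
  next
    assume "s' = s - ?D + 2 * n"
    moreover have "separated n C' d' (C + 2 * n) d" using assms(5) by (auto simp: separated_def)
    ultimately show ?thesis
      using profile_neq[of j' d' j d s s' n C' "C + 2 * n"] assms s by (auto simp: algebra_simps)
  qed
  then show ?thesis using abs_height[of j d n C T] abs_height[of j' d' n C' T] assms D
    unfolding s_def s'_def by simp
qed

text \<open>
  Until \<open>C'\<close> the first point is positive and the second negative, so the hypothesis fails. Afterwards,
  since heights change by at most one and never agree, the order can only be undone if the first
  point rises while the second falls. But a point rises in the first half of its way only and falls
  in the second half only, and the first point is ahead of the second.
\<close>

lemma separated_order_monotone:
  assumes "1 \<le> j" "j \<le> d" "1 \<le> j'" "j' \<le> d'" "separated n C d C' d'"
    and T: "C \<le> T" "T < C + 2 * n" and less: "height n C d j T < height n C' d' j' T"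
  shows "height n C d j (T + 1) < height n C' d' j' (T + 1)"
proof -
  have D: "C < C'" "C' < C + 2 * n" "d \<le> n" "d' \<le> n" and n: "0 < n"
    using assms by (auto simp: separated_def)
  note b = profile_bounds[of j d n] profile_bounds[of j' d' n]
  have T': "C' \<le> T"
  proof (rule ccontr)
    assume "\<not> C' \<le> T"
    then have "0 < height n C d j T" "0 < height n C' d' j' (T + 2 * n)"
      using T D n assms(1-4) b by (auto simp: height_eq_profile intro!: less_le_trans[OF zero_less_one])
    then show False using less height_antiperiodic(1)[OF n, of C' d' j' T] by linarith
  qed
  then have H: "height n C d j T = profile n d j (T - C)" "height n C' d' j' T = profile n d' j' (T - C')"
    using T D n by (simp_all add: height_eq_profile)
  show ?thesis
  proof (cases "T + 1 = C + 2 * n")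
    case True
    then have "height n C d j (T + 1) = - profile n d j 0"
      using n by (simp add: height_eq_minus_profile)
    moreover have "height n C' d' j' (T + 1) = profile n d' j' (T + 1 - C')"
      using T T' D n by (simp add: height_eq_profile)
    ultimately show ?thesis using b assms(1-4) D by (smt (verit))
  next
    case False
    have H1: "height n C d j (T + 1) = profile n d j (T - C + 1)"
      "height n C' d' j' (T + 1) = profile n d' j' (T - C' + 1)"
      using T T' D n False by (simp_all add: height_eq_profile algebra_simps)
    have "height n C d j (T + 1) \<noteq> height n C' d' j' (T + 1)"
      using abs_height_neq[OF assms(1-5), of "T + 1"] by auto
    \<comment> \<open>Undoing the order would need the first point to rise and the second to fall.\<close>
    moreover have "\<not> profile n d' j' (T - C' + 1) < profile n d j (T - C + 1)"
    proof
      assume "profile n d' j' (T - C' + 1) < profile n d j (T - C + 1)"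
      then have "profile n d j (T - C) < profile n d j (T - C + 1)"
        "profile n d' j' (T - C' + 1) < profile n d' j' (T - C')"
        using less H profile_diff[of n d j "T - C"] profile_diff[of n d' j' "T - C'"] by linarith+
      then show False using profile_increase profile_decrease D(1) by fastforce
    qed
    ultimately show ?thesis unfolding H1 by linarith
  qed
qed

section \<open>The points and their heights\<close>

text \<open>
  Indices are taken cyclically: the blocks \<open>i\<close> and \<open>i + length d\<close> are conjugate.
\<close>

definition block_size :: "nat list \<Rightarrow> nat \<Rightarrow> int"
  where "block_size d i = int (d ! (i mod length d))"

definition block_start :: "nat list \<Rightarrow> nat \<Rightarrow> int"
  where "block_start d i = (\<Sum>k<i. block_size d k)"

text \<open>
  The closed form of the recursion \<open>crossing_time_Suc\<close>, which is forced by the equality case of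
  \<open>crossing_gap\<close> below.
\<close>

definition crossing_time :: "nat list \<Rightarrow> nat \<Rightarrow> int"
  where "crossing_time d i = 2 * block_start d i + block_size d i"

text \<open>
  The pair \<open>(i, j)\<close> stands for the point at height \<open>j\<close> after the \<open>i\<close>-th crossing switch; \<open>i\<close> ranges
  over two halfperiods so that a point and its conjugate have different labels.
\<close>

definition points :: "nat list \<Rightarrow> (nat \<times> nat) set"
  where "points d = (SIGMA i:{..<2 * length d}. {1..d ! (i mod length d)})"

definition point_height :: "nat list \<Rightarrow> nat \<times> nat \<Rightarrow> int \<Rightarrow> int"
  where "point_height d x T =
    height (int (sum_list d)) (crossing_time d (fst x)) (block_size d (fst x)) (int (snd x)) T"

text \<open>
  At most one summand is nonzero, as the crossing times in a halfperiod are distinct modulo \<open>2 n\<close>.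
\<close>

definition crossing_size :: "nat list \<Rightarrow> int \<Rightarrow> int"
  where "crossing_size d T =
    (\<Sum>i<length d. if 2 * int (sum_list d) dvd T - crossing_time d i then block_size d i else 0)"

lemma block_size_add: "block_size d (i + length d) = block_size d i"
  by (simp add: block_size_def)

lemma block_start_add: "block_start d (i + length d) = block_start d i + int (sum_list d)"
proof (induction i)
  case 0
  have "block_start d (length d) = (\<Sum>k<length d. int (d ! k))"
    unfolding block_start_def by (intro sum.cong) (auto simp: block_size_def)
  then show ?case by (simp add: sum_list_sum_nth atLeast0LessThan) (simp add: block_start_def)
next
  case (Suc i)
  then show ?case using block_size_add[of d i] by (simp add: block_start_def)
qed

lemma crossing_time_add: "crossing_time d (i + length d) = crossing_time d i + 2 * int (sum_list d)"
  by (simp add: crossing_time_def block_start_add block_size_add)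

lemma crossing_time_Suc:
  "crossing_time d (Suc i) = crossing_time d i + block_size d i + block_size d (Suc i)"
  by (simp add: crossing_time_def block_start_def)

lemma block_start_mono: "i \<le> i' \<Longrightarrow> block_start d i \<le> block_start d i'"
  unfolding block_start_def by (intro sum_mono2) (auto simp: block_size_def)

lemma crossing_time_separated:
  assumes "i < i'" "i' < i + length d"
  shows "separated (int (sum_list d)) (crossing_time d i) (block_size d i)
    (crossing_time d i') (block_size d i')"
proof -
  have "block_start d i + block_size d i \<le> block_start d i'"
    using block_start_mono[of "Suc i" i' d] assms(1) by (simp add: block_start_def)
  moreover have "block_start d i' + block_size d i' \<le> block_start d i + int (sum_list d)"
    using block_start_mono[of "Suc i'" "i + length d" d] assms(2)
    by (simp add: block_start_add) (simp add: block_start_def)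
  ultimately show ?thesis by (simp add: separated_def crossing_time_def)
qed

lemma block_size_pos: "\<forall>x\<in>set d. 0 < x \<Longrightarrow> d \<noteq> [] \<Longrightarrow> 1 \<le> block_size d i"
  using nth_mem[of "i mod length d" d] by (fastforce simp: block_size_def Suc_le_eq)

lemma block_size_less:
  assumes "length d > 1" "\<forall>x\<in>set d. 0 < x"
  shows "block_size d i < int (sum_list d)"
proof -
  have "d \<noteq> []" using assms by auto
  then have "1 \<le> block_size d (Suc i)" by (rule block_size_pos[OF assms(2)])
  moreover have "separated (int (sum_list d)) (crossing_time d i) (block_size d i)
    (crossing_time d (Suc i)) (block_size d (Suc i))"
    using assms by (intro crossing_time_separated) auto
  ultimately show ?thesis by (auto simp: separated_def)
qed

lemma finite_points: "finite (points d)"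
  by (simp add: points_def)

lemma card_points: "card (points d) = 2 * sum_list d"
proof -
  have "int (card (points d)) = (\<Sum>i<2 * length d. block_size d i)"
    by (simp add: points_def block_size_def card_SigmaI)
  also have "\<dots> = block_start d (0 + length d + length d)"
    by (simp add: block_start_def mult_2)
  also have "\<dots> = 2 * int (sum_list d)"
    unfolding block_start_add by (simp add: block_start_def)
  finally show ?thesis by linarith
qed

text \<open>
  Orders two points so that the first one crosses at most half a period of \<open>4 n\<close> moves ahead of the
  second: in the three cases by \<open>0\<close>, by exactly \<open>2 n\<close> (then they belong to conjugate blocks) and by
  an amount strictly between. The alternative for \<open>C\<close> accounts for the period \<open>4 n\<close>.
\<close>

definition ahead :: "nat list \<Rightarrow> nat \<times> nat \<Rightarrow> nat \<times> nat \<Rightarrow> bool"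
  where "ahead d x y \<longleftrightarrow>
    fst x = fst y \<and> snd y < snd x \<or>
    fst y = fst x + length d \<or>
    (\<exists>C. (C = crossing_time d (fst y) \<or> C = crossing_time d (fst y) + 4 * int (sum_list d)) \<and>
      separated (int (sum_list d)) (crossing_time d (fst x)) (block_size d (fst x)) C
        (block_size d (fst y)))"

lemma ahead_total:
  assumes "x \<in> points d" "y \<in> points d" "x \<noteq> y"
  shows "ahead d x y \<or> ahead d y x"
proof -
  have *: "ahead d x y \<or> ahead d y x"
    if xy: "x \<in> points d" "y \<in> points d" and lt: "fst x < fst y" for x y
  proof -
    consider "fst y < fst x + length d" | "fst y = fst x + length d" | "fst x + length d < fst y"
      by linarith
    then show ?thesis
    proof cases
      case 1
      then show ?thesis using crossing_time_separated[OF lt 1] unfolding ahead_def by blast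
    next
      case 2
      then show ?thesis unfolding ahead_def by blast
    next
      case 3
      have "fst y < 2 * length d" using xy by (auto simp: points_def)
      then have "separated (int (sum_list d)) (crossing_time d (fst y)) (block_size d (fst y))
        (crossing_time d (fst x + length d + length d)) (block_size d (fst x + length d + length d))"
        using 3 by (intro crossing_time_separated) auto
      then have "separated (int (sum_list d)) (crossing_time d (fst y)) (block_size d (fst y))
        (crossing_time d (fst x) + 4 * int (sum_list d)) (block_size d (fst x))"
        unfolding crossing_time_add block_size_add by (simp add: add.commute)
      then have "ahead d y x" unfolding ahead_def by blast
      then show ?thesis ..
    qed
  qed
  consider "fst x < fst y" | "fst y < fst x" | "fst x = fst y" "snd x < snd y" | "fst x = fst y" "snd y < snd x"
    using assms(3) by (metis linorder_neqE_nat prod.expand)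
  then show ?thesis
    by cases (use *[of x y] *[of y x] assms in \<open>auto simp: ahead_def\<close>)
qed

context
  fixes d :: "nat list" and n :: int
  assumes long: "length d > 1" and positive: "\<forall>x\<in>set d. 0 < x"
  defines "n \<equiv> int (sum_list d)"
begin

lemma n_pos: "0 < n"
proof -
  have "d \<noteq> []" using long by auto
  then show ?thesis
    using block_size_pos[OF positive, of 0] block_size_less[OF long positive, of 0] by (simp add: n_def)
qed

lemma point_ranges:
  assumes "x \<in> points d"
  shows "1 \<le> int (snd x)" "int (snd x) \<le> block_size d (fst x)" "block_size d (fst x) \<le> n"
  using assms block_size_less[OF long positive, of "fst x"]
  by (auto simp: points_def block_size_def n_def)

lemma point_height_antiperiodic:
  "point_height d x (T + 2 * n) = - point_height d x T"
  "point_height d (i + length d, j) T = - point_height d (i, j) T"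
  using height_antiperiodic[OF n_pos]
  by (simp_all add: point_height_def n_def crossing_time_add block_size_add)

text \<open>
  The window starts when \<open>x\<close> becomes positive. In the first two cases of \<open>ahead\<close>, \<open>y\<close> is below \<open>x\<close>
  throughout the window.
\<close>

lemma point_height_ahead:
  assumes "x \<in> points d" "y \<in> points d" "ahead d x y"
  shows "point_height d x T \<noteq> point_height d y T"
    and "\<exists>T0. \<forall>T. T0 \<le> T \<longrightarrow> T < T0 + 2 * n \<longrightarrow>
      point_height d x T < point_height d y T \<longrightarrow> point_height d x (T + 1) < point_height d y (T + 1)"
proof -
  let ?C = "crossing_time d (fst x)" and ?D = "block_size d (fst x)"
  note rx = point_ranges[OF assms(1)] and ry = point_ranges[OF assms(2)]
  consider (same) "fst x = fst y" "snd y < snd x" | (opposite) "fst y = fst x + length d"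
    | (apart) C where "C = crossing_time d (fst y) \<or> C = crossing_time d (fst y) + 4 * int (sum_list d)"
      "separated (int (sum_list d)) ?C ?D C (block_size d (fst y))"
    using assms(3) unfolding ahead_def by blast
  then have "point_height d x T \<noteq> point_height d y T \<and> (\<exists>T0. \<forall>T. T0 \<le> T \<longrightarrow> T < T0 + 2 * n \<longrightarrow>
      point_height d x T < point_height d y T \<longrightarrow> point_height d x (T + 1) < point_height d y (T + 1))"
  proof cases
    case same
    note eq = same(1) and less = same(2)
    have "point_height d y T < point_height d x T" if "?C \<le> T" "T < ?C + 2 * n" for T
      using that eq less n_pos profile_less[of "int (snd y)" "int (snd x)"]
      by (simp add: point_height_def height_eq_profile flip: n_def)
    then have "\<forall>T. ?C \<le> T \<longrightarrow> T < ?C + 2 * n \<longrightarrow> \<not> point_height d x T < point_height d y T"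
      by (simp add: order_less_imp_le not_less)
    moreover have "point_height d x T \<noteq> point_height d y T"
      using eq profile_less[of "int (snd y)" "int (snd x)" n ?D "(T - ?C) mod (2 * n)"] less
      by (simp add: point_height_def height_def flip: n_def)
    ultimately show ?thesis by blast
  next
    case opposite
    note eq = opposite
    have y: "point_height d y T = - height n ?C ?D (int (snd y)) T" for T
      using height_antiperiodic(2)[OF n_pos] eq
      by (simp add: point_height_def crossing_time_add block_size_add flip: n_def)
    have px: "point_height d x T = height n ?C ?D (int (snd x)) T" for T
      by (simp add: point_height_def n_def)
    have ry': "int (snd y) \<le> ?D" using ry(2) eq by (simp add: block_size_add)
    have "\<not> point_height d x T < point_height d y T" if "?C \<le> T" "T < ?C + 2 * n" for T
      using that n_pos profile_bounds[of "int (snd x)" ?D n "T - ?C"]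
        profile_bounds[of "int (snd y)" ?D n "T - ?C"] rx ry ry'
      unfolding y px by (simp add: height_eq_profile)
    moreover have "point_height d x T \<noteq> point_height d y T"
      using profile_bounds[of "int (snd x)" ?D n "(T - ?C) mod (2 * n)"]
        profile_bounds[of "int (snd y)" ?D n "(T - ?C) mod (2 * n)"] rx ry ry'
      unfolding y px by (simp add: height_def)
    ultimately show ?thesis by blast
  next
    case apart
    note C = apart(1) and sep = apart(2)[folded n_def]
    have "height n (C' + 4 * n) D j T = height n C' D j T" for C' D j T
    proof -
      have "C' + 4 * n = C' + 2 * n + 2 * n" by simp
      then show ?thesis by (simp only: height_antiperiodic(2)[OF n_pos] minus_minus)
    qed
    then have y: "point_height d y T = height n C (block_size d (fst y)) (int (snd y)) T" for T
      using C by (auto simp: point_height_def n_def)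
    have x: "point_height d x T = height n ?C ?D (int (snd x)) T" for T
      by (simp add: point_height_def n_def)
    have "point_height d x T \<noteq> point_height d y T"
      using abs_height_neq[OF rx(1,2) ry(1,2) sep, of T] by (auto simp: x y)
    moreover have "\<forall>T. ?C \<le> T \<longrightarrow> T < ?C + 2 * n \<longrightarrow>
      point_height d x T < point_height d y T \<longrightarrow> point_height d x (T + 1) < point_height d y (T + 1)"
      unfolding x y using separated_order_monotone[OF rx(1,2) ry(1,2) sep] by blast
    ultimately show ?thesis by blast
  qed
  then show "point_height d x T \<noteq> point_height d y T"
    "\<exists>T0. \<forall>T. T0 \<le> T \<longrightarrow> T < T0 + 2 * n \<longrightarrow>
      point_height d x T < point_height d y T \<longrightarrow> point_height d x (T + 1) < point_height d y (T + 1)"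
    by blast+
qed

lemma point_height_inj: "inj_on (\<lambda>x. point_height d x T) (points d)"
proof (rule inj_onI, rule ccontr)
  fix x y
  assume xy: "x \<in> points d" "y \<in> points d" "point_height d x T = point_height d y T" "x \<noteq> y"
  then consider "ahead d x y" | "ahead d y x" using ahead_total by blast
  then show False
    by cases (use xy point_height_ahead(1)[of x y T] point_height_ahead(1)[of y x T] in auto)
qed

lemma point_height_bij: "bij_betw (\<lambda>x. point_height d x T) (points d) ({- n..n} - {0})"
proof -
  have "(\<lambda>x. point_height d x T) ` points d \<subseteq> {- n..n} - {0}"
  proof
    fix k assume "k \<in> (\<lambda>x. point_height d x T) ` points d"
    then obtain x where x: "x \<in> points d" "k = point_height d x T" by blast
    have "1 \<le> \<bar>k\<bar> \<and> \<bar>k\<bar> \<le> n"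
      using point_ranges[OF x(1)] x(2)
      by (simp add: point_height_def abs_height profile_bounds flip: n_def)
    then show "k \<in> {- n..n} - {0}" by auto
  qed
  moreover have "card ((\<lambda>x. point_height d x T) ` points d) = card ({- n..n} - {0})"
    using n_pos by (simp add: card_image[OF point_height_inj] card_points n_def)
  ultimately show ?thesis using point_height_inj unfolding bij_betw_def
    by (simp add: card_subset_eq)
qed

lemma pair_switches_once:
  assumes "x \<in> points d" "y \<in> points d" "x \<noteq> y"
  shows "\<exists>!i. i \<in> {1..2 * n} \<and>
    (point_height d x (i - 1) < point_height d y (i - 1)) \<noteq> (point_height d x i < point_height d y i)"
proof -
  have once: "\<exists>!i. i \<in> {1..2 * n} \<and>
      (point_height d x (i - 1) < point_height d y (i - 1)) \<noteq> (point_height d x i < point_height d y i)"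
    if xy: "x \<in> points d" "y \<in> points d" "ahead d x y" for x y
  proof -
    obtain T0 where T0: "\<And>T. T0 \<le> T \<Longrightarrow> T < T0 + 2 * n \<Longrightarrow>
      point_height d x T < point_height d y T \<Longrightarrow> point_height d x (T + 1) < point_height d y (T + 1)"
      using point_height_ahead(2)[OF xy] by blast
    have anti: "point_height d x (T + 2 * n) < point_height d y (T + 2 * n) \<longleftrightarrow>
      \<not> point_height d x T < point_height d y T" for T
      using point_height_ahead(1)[OF xy, of T] by (auto simp: point_height_antiperiodic)
    show ?thesis
      using monotone_window_changes_once[of "2 * n" "\<lambda>T. point_height d x T < point_height d y T" T0]
        anti T0 n_pos by simp
  qed
  consider "ahead d x y" | "ahead d y x" using ahead_total assms by blast
  then show ?thesis
  proof cases
    case 2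
    have "(point_height d y T < point_height d x T) = (\<not> point_height d x T < point_height d y T)" for T
      using point_height_ahead(1)[OF assms(2,1) 2, of T] by auto
    then show ?thesis using once[OF assms(2,1) 2] by simp
  qed (rule once[OF assms(1,2)])
qed

lemma crossing_size_eq:
  assumes "2 * n dvd T - crossing_time d i"
  shows "crossing_size d T = block_size d i"
proof -
  let ?f = "\<lambda>k. if 2 * n dvd T - crossing_time d k then block_size d k else 0"
  let ?i = "i mod length d"
  have red: "crossing_time d (k + length d * m) = crossing_time d k + 2 * n * int m" for k m
  proof (induction m)
    case (Suc m)
    have "crossing_time d (k + length d * Suc m) = crossing_time d ((k + length d * m) + length d)"
      by (simp add: ac_simps)
    then show ?case unfolding crossing_time_add Suc by (simp add: n_def algebra_simps)
  qed simp
  have "crossing_time d i = crossing_time d ?i + 2 * n * int (i div length d)"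
    using red[of ?i "i div length d"] by simp
  then have "T - crossing_time d ?i = (T - crossing_time d i) + 2 * n * int (i div length d)" by simp
  then have i: "2 * n dvd T - crossing_time d ?i" using assms by (metis dvd_add dvd_triv_left)
  have *: "\<not> 2 * n dvd T - crossing_time d k" if "2 * n dvd T - crossing_time d l" "k < l" "l < length d" for k l
  proof
    assume "2 * n dvd T - crossing_time d k"
    then have "2 * n dvd crossing_time d l - crossing_time d k"
      using dvd_diff[OF _ that(1), of "T - crossing_time d k"] by simp
    moreover have "0 < crossing_time d l - crossing_time d k" "crossing_time d l - crossing_time d k < 2 * n"
      using crossing_time_separated[of k l d] that block_size_pos[OF positive, of k] block_size_pos[OF positive, of l] long
      by (fastforce simp: separated_def n_def)+
    ultimately show False using zdvd_not_zless by blast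
  qed
  have "crossing_size d T = (\<Sum>k<length d. ?f k)" by (simp add: crossing_size_def n_def)
  also have "\<dots> = (\<Sum>k\<in>{?i}. ?f k)"
  proof (rule sum.mono_neutral_right)
    show "\<forall>k\<in>{..<length d} - {?i}. ?f k = 0"
    proof
      fix k assume k: "k \<in> {..<length d} - {?i}"
      have il: "?i < length d" using long by (intro mod_less_divisor) auto
      consider "k < ?i" | "?i < k" using k by force
      then have "\<not> 2 * n dvd T - crossing_time d k"
        by cases (use *[OF i] *[of k ?i] il k i in auto)
      then show "?f k = 0" by simp
    qed
    show "{?i} \<subseteq> {..<length d}" using long by (auto intro!: mod_less_divisor)
  qed simp
  also have "\<dots> = block_size d i" using i by (simp add: block_size_def)
  finally show ?thesis .
qed

lemma crossing_size_nonzero: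
  assumes "crossing_size d T \<noteq> 0"
  obtains i where "i < length d" "2 * n dvd T - crossing_time d i"
proof -
  have "\<exists>i\<in>{..<length d}. (if 2 * n dvd T - crossing_time d i then block_size d i else 0) \<noteq> 0"
  proof (rule ccontr)
    assume "\<not> ?thesis"
    then have "crossing_size d T = 0" unfolding crossing_size_def n_def by (intro sum.neutral) auto
    then show False using assms by simp
  qed
  then show thesis using that by (metis lessThan_iff)
qed

lemma crossing_size_bounds: "0 \<le> crossing_size d T" "crossing_size d T < n"
proof -
  have "0 \<le> crossing_size d T \<and> crossing_size d T < n"
  proof (cases "crossing_size d T = 0")
    case True
    then show ?thesis using n_pos by simp
  next
    case False
    then obtain i where "2 * n dvd T - crossing_time d i" by (rule crossing_size_nonzero)
    then have "crossing_size d T = block_size d i" by (rule crossing_size_eq)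
    then show ?thesis using block_size_less[OF long positive, of i] by (simp add: n_def block_size_def)
  qed
  then show "0 \<le> crossing_size d T" "crossing_size d T < n" by blast+
qed

lemma step_at_crossing:
  assumes x: "x \<in> points d" and dvd: "2 * n dvd T - crossing_time d (fst x)"
  shows "\<bar>point_height d x (T - 1)\<bar> = int (snd x)"
    and "point_height d x T = - point_height d x (T - 1)"
proof -
  define q where "q = (T - crossing_time d (fst x)) div (2 * n)"
  have T: "T - crossing_time d (fst x) = 2 * n * q" using dvd by (simp add: q_def)
  have 1: "(2 * n * q - 1) div (2 * n) = q - 1" "(2 * n * q - 1) mod (2 * n) = 2 * n - 1"
  proof -
    have e: "2 * n * q - 1 = (2 * n - 1) + (2 * n) * (q - 1)" by (simp add: algebra_simps)
    have "(2 * n - 1) div (2 * n) = 0" "(2 * n - 1) mod (2 * n) = 2 * n - 1"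
      using n_pos by (simp_all add: div_pos_pos_trivial mod_pos_pos_trivial del: minus_mod_self1)
    then show "(2 * n * q - 1) div (2 * n) = q - 1" "(2 * n * q - 1) mod (2 * n) = 2 * n - 1"
      unfolding e using n_pos by (simp_all only: div_mult_self2 mod_mult_self2)
  qed
  have T1: "T - 1 - crossing_time d (fst x) = 2 * n * q - 1" using T by simp
  have p: "profile n (block_size d (fst x)) (int (snd x)) (2 * n - 1) = int (snd x)"
     "profile n (block_size d (fst x)) (int (snd x)) 0 = int (snd x)"
    using profile_ends point_ranges[OF x] by blast+
  show "\<bar>point_height d x (T - 1)\<bar> = int (snd x)" "point_height d x T = - point_height d x (T - 1)"
    unfolding point_height_def height_def n_def[symmetric] T T1 1 using n_pos p by simp_all
qed

text \<open>
  The last two claims hold by counting: the heights up to \<open>crossing_size d T\<close> in absolute value are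
  taken by the points of the crossing block and its conjugate.
\<close>

lemma step_off_crossing:
  assumes x: "x \<in> points d" and dvd: "\<not> 2 * n dvd T - crossing_time d (fst x)"
  shows "\<bar>point_height d x T - point_height d x (T - 1)\<bar> \<le> 1"
    and "0 < point_height d x T \<longleftrightarrow> 0 < point_height d x (T - 1)"
    and "crossing_size d T < \<bar>point_height d x (T - 1)\<bar>"
    and "crossing_size d T < \<bar>point_height d x T\<bar>"
proof -
  define q where "q = (T - crossing_time d (fst x)) div (2 * n)"
  define r where "r = (T - crossing_time d (fst x)) mod (2 * n)"
  have T: "T - crossing_time d (fst x) = r + 2 * n * q" by (simp add: q_def r_def)
  have r: "0 < r" "r < 2 * n"
  proof -
    have "r \<noteq> 0" using dvd by (simp add: r_def dvd_eq_mod_eq_0)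
    moreover have "0 \<le> r" "r < 2 * n" using n_pos by (simp_all add: r_def)
    ultimately show "0 < r" "r < 2 * n" by linarith+
  qed
  have 1: "(r - 1 + 2 * n * q) div (2 * n) = q" "(r - 1 + 2 * n * q) mod (2 * n) = r - 1"
    "(r + 2 * n * q) div (2 * n) = q" "(r + 2 * n * q) mod (2 * n) = r"
    using r by (simp_all add: div_mult_self2 mod_mult_self2)
  have T1: "T - 1 - crossing_time d (fst x) = r - 1 + 2 * n * q" using T by simp
  let ?p = "profile n (block_size d (fst x)) (int (snd x))"
  let ?s = "if even q then 1 else - 1 :: int"
  have h: "point_height d x T = ?s * ?p r" "point_height d x (T - 1) = ?s * ?p (r - 1)"
    unfolding point_height_def height_def n_def[symmetric] T T1 1 by simp_all
  have p: "\<bar>?p r - ?p (r - 1)\<bar> \<le> 1" using profile_diff[of n _ _ "r - 1"] by simp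
  have pp: "1 \<le> ?p r" "1 \<le> ?p (r - 1)" using profile_bounds point_ranges[OF x] by blast+
  show "\<bar>point_height d x T - point_height d x (T - 1)\<bar> \<le> 1"
    "0 < point_height d x T \<longleftrightarrow> 0 < point_height d x (T - 1)"
    using p pp unfolding h by (auto simp: abs_minus_commute)
  have low: False if U: "U = T \<or> U = T - 1" and le: "\<bar>point_height d x U\<bar> \<le> crossing_size d T" for U
  proof -
    define k where "k = nat \<bar>point_height d x U\<bar>"
    have k1: "1 \<le> k" using U pp h by (auto simp: k_def)
    have "crossing_size d T \<noteq> 0" using k1 le by (auto simp: k_def)
    then obtain i where i: "i < length d" "2 * n dvd T - crossing_time d i" by (rule crossing_size_nonzero)
    have e: "crossing_size d T = block_size d i" by (rule crossing_size_eq[OF i(2)])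
    have y: "(i, k) \<in> points d" "(i + length d, k) \<in> points d"
      using i le e k1 by (auto simp: points_def k_def block_size_def)
    have "\<bar>point_height d (i, k) U\<bar> = int k"
      using step_at_crossing[OF y(1), of T] i(2) U by auto
    \<comment> \<open>The point of the crossing block, or its conjugate, that is already at the height of \<open>x\<close>.\<close>
    then have "point_height d (i, k) U = point_height d x U \<or>
      point_height d (i + length d, k) U = point_height d x U"
      unfolding point_height_antiperiodic(2) by (auto simp: k_def)
    then have "x = (i, k) \<or> x = (i + length d, k)"
      using inj_onD[OF point_height_inj[of U]] x y by metis
    moreover have "2 * n dvd T - crossing_time d (i + length d)"
    proof -
      have "T - crossing_time d (i + length d) = (T - crossing_time d i) - 2 * n"
        by (simp add: crossing_time_add n_def)
      then show ?thesis using dvd_diff[OF i(2) dvd_refl] by (simp only:)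
    qed
    ultimately show False using dvd i(2) by auto
  qed
  show "crossing_size d T < \<bar>point_height d x (T - 1)\<bar>" "crossing_size d T < \<bar>point_height d x T\<bar>"
    using low[of "T - 1"] low[of T] by (simp_all only: not_less[symmetric]) blast+
qed

text \<open>
  A block rests only at its crossing and at its turning point, \<open>n\<close> moves later; the first two blocks
  cannot be at their turning points simultaneously.
\<close>

lemma some_point_moves:
  assumes "crossing_size d T = 0"
  shows "\<exists>x\<in>points d. point_height d x (T - 1) \<noteq> point_height d x T"
proof -
  define s where "s i = (T - crossing_time d i) mod (2 * n)" for i
  have nz: "s i \<noteq> 0" for i
  proof
    assume "s i = 0"
    then have "crossing_size d T = block_size d i" by (intro crossing_size_eq) (auto simp: s_def)
    then show False using assms block_size_pos[OF positive, of i] long by fastforce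
  qed
  have "s 0 \<noteq> n \<or> s 1 \<noteq> n"
  proof (rule ccontr)
    assume "\<not> ?thesis"
    then have "s 0 = s 1" by simp
    then have "2 * n dvd (T - crossing_time d 0) - (T - crossing_time d 1)"
      unfolding s_def by (simp only: mod_eq_dvd_iff)
    then have "2 * n dvd crossing_time d 1 - crossing_time d 0" by simp
    moreover have "separated n (crossing_time d 0) (block_size d 0) (crossing_time d 1) (block_size d 1)"
      unfolding n_def using long by (intro crossing_time_separated) auto
    ultimately show False using zdvd_not_zless block_size_pos[OF positive, of 0]
        block_size_pos[OF positive, of 1] long by (fastforce simp: separated_def)
  qed
  then obtain i where i: "i < length d" "s i \<noteq> n" using long by (metis gr_implies_not0 not_gr_zero less_trans zero_less_one)
  have r: "1 \<le> s i" "s i < 2 * n" 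
  proof -
    have "0 \<le> s i" "s i < 2 * n" unfolding s_def using n_pos by simp_all
    then show "1 \<le> s i" "s i < 2 * n" using nz[of i] by linarith+
  qed
  have D: "1 \<le> block_size d i" "block_size d i < n"
    using block_size_pos[OF positive, of i] block_size_less[OF long positive, of i] long
    unfolding n_def by fastforce+
  obtain j where j: "1 \<le> j" "j \<le> block_size d i"
    "profile n (block_size d i) j (s i - 1) \<noteq> profile n (block_size d i) j (s i)"
    using profile_moves[OF D r i(2)] by blast
  have x: "(i, nat j) \<in> points d" using i j by (auto simp: points_def block_size_def)
  have "(T - 1 - crossing_time d i) mod (2 * n) = (s i - 1) mod (2 * n)"
    unfolding s_def by (simp add: mod_simps algebra_simps)
  also have "\<dots> = s i - 1" using r by simp
  finally have "(T - 1 - crossing_time d i) mod (2 * n) = s i - 1" .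
  then have "\<bar>point_height d (i, nat j) (T - 1)\<bar> \<noteq> \<bar>point_height d (i, nat j) T\<bar>"
    using j D by (simp add: point_height_def abs_height s_def flip: n_def)
  then show ?thesis using x by (intro bexI[of _ "(i, nat j)"]) auto
qed

end

section \<open>Existence\<close>

text \<open>
  The labels \<open>idx\<close> identify the points of \<open>\<pi>\<close> with the pairs in \<open>points d\<close>, in such a way that \<open>\<pi>\<close>
  becomes the motion described by \<open>point_height\<close>.
\<close>

definition follows_heights :: "nat list \<Rightarrow> 'a set \<Rightarrow> (int \<Rightarrow> 'a list) \<Rightarrow> ('a \<Rightarrow> nat \<times> nat) \<Rightarrow> bool"
  where "follows_heights d P \<pi> idx \<longleftrightarrow> bij_betw idx P (points d) \<and>
    (\<forall>T. \<pi> T \<in> permutations_of_set P \<and>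
      (\<forall>p\<in>P. signed_pos (sum_list d) (\<pi> T) p = point_height d (idx p) T))"

lemma permutation_from_positions:
  assumes "bij_betw g P {1..m}"
  shows "\<exists>xs \<in> permutations_of_set P. \<forall>p\<in>P. pos xs p = g p"
proof -
  define xs where "xs = map (inv_into P g) [1..<Suc m]"
  have inv: "bij_betw (inv_into P g) {1..m} P" by (rule bij_betw_inv_into[OF assms])
  have s: "set [1..<Suc m] = {1..m}" by auto
  have "set xs = P" unfolding xs_def set_map s using inv by (simp add: bij_betw_def)
  moreover have "distinct xs" unfolding xs_def distinct_map s using inv by (simp add: bij_betw_def)
  moreover have "pos xs p = g p" if "p \<in> P" for p
  proof -
    have g: "g p \<in> {1..m}" using assms that by (auto simp: bij_betw_def)
    have "xs ! (g p - 1) = inv_into P g ([1..<Suc m] ! (g p - 1))"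
      unfolding xs_def using g by (intro nth_map) auto
    also have "[1..<Suc m] ! (g p - 1) = g p" using g by (subst nth_upt) auto
    also have "inv_into P g (g p) = p" using assms that by (simp add: bij_betw_def)
    finally show ?thesis using g \<open>set xs = P\<close> \<open>distinct xs\<close> that
      by (subst pos_eq_iff) (auto simp: xs_def)
  qed
  ultimately show ?thesis by (auto simp: permutations_of_set_def)
qed

context
  fixes d :: "nat list" and n :: nat
  assumes long: "length d > 1" and positive: "\<forall>x\<in>set d. 0 < x"
  defines "n \<equiv> sum_list d"
begin

lemma follows_heights_exists:
  assumes idx: "bij_betw idx P (points d)"
  shows "\<exists>\<pi>. follows_heights d P \<pi> idx"
proof -
  have "\<exists>xs \<in> permutations_of_set P. \<forall>p\<in>P. signed_pos n xs p = point_height d (idx p) T" for T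
  proof -
    \<comment> \<open>The position that \<open>signed_pos\<close> turns into the height \<open>k\<close>.\<close>
    define v where "v k = nat (if 0 < k then int n + k else int n + 1 + k)" for k
    have "bij_betw v ({- int n..int n} - {0}) {1..2 * n}"
      by (rule bij_betw_byWitness[of _ "\<lambda>m. if n < m then int m - int n else int m - int n - 1"])
        (auto simp: v_def split: if_splits)
    then have "bij_betw (v \<circ> (\<lambda>x. point_height d x T) \<circ> idx) P {1..2 * n}"
      using point_height_bij[OF long positive, of T] idx unfolding n_def by (blast intro: bij_betw_trans)
    then obtain xs where xs: "xs \<in> permutations_of_set P"
      "\<And>p. p \<in> P \<Longrightarrow> pos xs p = v (point_height d (idx p) T)"
      using permutation_from_positions by fastforce
    have "signed_pos n xs p = point_height d (idx p) T" if "p \<in> P" for p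
    proof -
      have "idx p \<in> points d" using idx that by (auto simp: bij_betw_def)
      then have "point_height d (idx p) T \<in> {- int n..int n} - {0}"
        using bij_betwE[OF point_height_bij[OF long positive, of T]] unfolding n_def by blast
      then show ?thesis using xs(2)[OF that] by (auto simp: signed_pos_def v_def)
    qed
    then show ?thesis using xs(1) by blast
  qed
  then have "\<exists>\<pi>. \<forall>T. \<pi> T \<in> permutations_of_set P \<and> (\<forall>p\<in>P. signed_pos n (\<pi> T) p = point_height d (idx p) T)"
    by (intro choice) blast
  then show ?thesis using idx unfolding follows_heights_def n_def by blast
qed

lemma crossing_times_in_halfperiod:
  "filter (\<lambda>i. crossing_size d i \<noteq> 0) [1..2 * int n] = map (crossing_time d) [0..<length d]"
proof (rule sorted_distinct_set_unique)
  have n0: "0 < int n" using n_pos[OF long positive] by (simp add: n_def)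
  have pos: "1 \<le> block_size d i" for i using block_size_pos[OF positive] long by (metis less_zeroE list.size(3))
  have lt: "crossing_time d i < crossing_time d j" if "i < j" "j < length d" for i j
    using crossing_time_separated[of i j d] that pos[of i] pos[of j] by (auto simp: separated_def)
  have range: "1 \<le> crossing_time d i \<and> crossing_time d i \<le> 2 * int n" if "i < length d" for i
  proof -
    have "block_start d (Suc i) \<le> block_start d (0 + length d)"
      using that by (intro block_start_mono) simp
    also have "\<dots> = int n" unfolding block_start_add n_def by (simp add: block_start_def)
    finally have "block_start d i + block_size d i \<le> int n" by (simp add: block_start_def)
    moreover have "0 \<le> block_start d i" unfolding block_start_def
      using pos by (intro sum_nonneg) (metis order_trans zero_le_one)
    ultimately show ?thesis using pos[of i] by (simp add: crossing_time_def)
  qed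
  show "sorted (filter (\<lambda>i. crossing_size d i \<noteq> 0) [1..2 * int n])"
    by (simp add: sorted_wrt_filter)
  show "distinct (filter (\<lambda>i. crossing_size d i \<noteq> 0) [1..2 * int n])" by simp
  show "sorted (map (crossing_time d) [0..<length d])"
    unfolding sorted_iff_nth_mono_less by (auto intro: less_imp_le lt)
  show "distinct (map (crossing_time d) [0..<length d])"
    unfolding distinct_map by (auto intro!: linorder_inj_onI dest: lt)
  have "{T \<in> {1..2 * int n}. crossing_size d T \<noteq> 0} = crossing_time d ` {0..<length d}"
  proof (intro equalityI subsetI)
    fix T assume T: "T \<in> {T \<in> {1..2 * int n}. crossing_size d T \<noteq> 0}"
    then obtain i where i: "i < length d" "2 * int n dvd T - crossing_time d i"
      using crossing_size_nonzero[OF long positive, of T] unfolding n_def by auto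
    have "T = crossing_time d i"
    proof (rule ccontr)
      assume "T \<noteq> crossing_time d i"
      then have "2 * int n \<le> \<bar>T - crossing_time d i\<bar>"
        using i(2) dvd_imp_le_int[of "T - crossing_time d i" "2 * int n"] by simp
      then show False using T range[OF i(1)] by auto
    qed
    then show "T \<in> crossing_time d ` {0..<length d}" using i(1) by simp
  next
    fix T assume "T \<in> crossing_time d ` {0..<length d}"
    then obtain i where i: "i < length d" "T = crossing_time d i" by auto
    have "crossing_size d T = block_size d i"
      using crossing_size_eq[OF long positive, of T i] i(2) by simp
    then show "T \<in> {T \<in> {1..2 * int n}. crossing_size d T \<noteq> 0}"
      using range[OF i(1)] i(2) pos[of i] by simp
  qed
  then show "set (filter (\<lambda>i. crossing_size d i \<noteq> 0) [1..2 * int n]) =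
    set (map (crossing_time d) [0..<length d])" by simp
qed

theorem follows_heights_realizes:
  assumes "follows_heights d P \<pi> idx"
  shows "realizes P \<pi> d"
proof -
  have idx: "bij_betw idx P (points d)"
    and perm: "\<And>T. \<pi> T \<in> permutations_of_set P"
    and s: "\<And>T p. p \<in> P \<Longrightarrow> signed_pos n (\<pi> T) p = point_height d (idx p) T"
    using assms unfolding follows_heights_def n_def by blast+
  note s' = s[unfolded n_def]
  have dist: "distinct (\<pi> T)" and setP: "set (\<pi> T) = P" for T
    using perm[of T] by (auto simp: permutations_of_set_def)
  have fin: "finite P" using bij_betw_finite[OF idx] finite_points by blast
  have card: "card P = 2 * n" using bij_betw_same_card[OF idx] card_points n_def by simp
  have len: "length (\<pi> T) = 2 * n" for T using dist setP card by (metis distinct_card)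
  have n0: "0 < n" using n_pos[OF long positive] by (simp add: n_def)
  have pts: "idx p \<in> points d" if "p \<in> P" for p using idx that by (auto simp: bij_betw_def)
  have half: "\<pi> (T + 2 * int n) = rev (\<pi> T)" for T
  proof (rule nth_equalityI)
    fix k assume k: "k < length (\<pi> (T + 2 * int n))"
    define p where "p = \<pi> (T + 2 * int n) ! k"
    have p: "p \<in> P" using k nth_mem setP by (metis p_def)
    have "pos (\<pi> (T + 2 * int n)) p = Suc k" unfolding p_def using pos_nth[OF dist k] .
    moreover have "signed_pos n (\<pi> (T + 2 * int n)) p = - signed_pos n (\<pi> T) p"
      using p by (simp add: s' point_height_antiperiodic[OF long positive] n_def)
    then have "pos (\<pi> (T + 2 * int n)) p + pos (\<pi> T) p = 2 * n + 1"
      by (rule signed_pos_opposite)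
    ultimately have "pos (\<pi> T) p = 2 * n - k" by simp
    then have "\<pi> T ! (2 * n - k - 1) = p" using nth_pos[OF dist, of p T] p setP by simp
    then show "\<pi> (T + 2 * int n) ! k = rev (\<pi> T) ! k" using k len by (simp add: rev_nth p_def)
  qed (simp add: len)
  have move: "switches (\<pi> (i - 1)) (\<pi> i) \<noteq> {}"
    "\<forall>b \<in> switches (\<pi> (i - 1)) (\<pi> i) - crossing_switches (\<pi> (i - 1)) (\<pi> i). length b = 2"
    "crossing_switches (\<pi> (i - 1)) (\<pi> i) = {} \<longleftrightarrow> crossing_size d i = 0"
    "crossing_size d i \<noteq> 0 \<Longrightarrow>
      int (length (the_elem (crossing_switches (\<pi> (i - 1)) (\<pi> i))) div 2) = crossing_size d i" for i
  proof -
    note * = central_move[OF dist dist _ len, of "i - 1" i "crossing_size d i"]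
    have side: "0 \<le> crossing_size d i" "crossing_size d i \<le> int n"
      using crossing_size_bounds[OF long positive, of i] by (simp_all add: n_def)
    have inner: "signed_pos n (\<pi> i) p = - signed_pos n (\<pi> (i - 1)) p"
      if "p \<in> set (\<pi> (i - 1))" "\<bar>signed_pos n (\<pi> (i - 1)) p\<bar> \<le> crossing_size d i" for p
    proof -
      have p: "p \<in> P" using that setP by simp
      show ?thesis
      proof (cases "2 * int n dvd i - crossing_time d (fst (idx p))")
        case True
        then show ?thesis using step_at_crossing(2)[OF long positive pts[OF p], of i] p by (simp add: s' n_def)
      next
        case False
        then show ?thesis
          using step_off_crossing(3)[OF long positive pts[OF p], of i] p that by (simp add: s' n_def)
      qed
    qed
    have outer: "\<bar>signed_pos n (\<pi> i) p - signed_pos n (\<pi> (i - 1)) p\<bar> \<le> 1 \<and>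
      (0 < signed_pos n (\<pi> i) p \<longleftrightarrow> 0 < signed_pos n (\<pi> (i - 1)) p) \<and>
      crossing_size d i < \<bar>signed_pos n (\<pi> i) p\<bar>"
      if "p \<in> set (\<pi> (i - 1))" "crossing_size d i < \<bar>signed_pos n (\<pi> (i - 1)) p\<bar>" for p
    proof -
      have p: "p \<in> P" using that setP by simp
      have "\<not> 2 * int n dvd i - crossing_time d (fst (idx p))"
      proof
        assume dvd: "2 * int n dvd i - crossing_time d (fst (idx p))"
        then have "\<bar>point_height d (idx p) (i - 1)\<bar> \<le> block_size d (fst (idx p))"
          using step_at_crossing(1)[OF long positive pts[OF p], of i] point_ranges[OF long positive pts[OF p]]
          by (simp add: n_def)
        moreover have "crossing_size d i = block_size d (fst (idx p))"
          using crossing_size_eq[OF long positive, of i] dvd by (simp add: n_def)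
        ultimately show False using that(2) p by (simp add: s)
      qed
      then show ?thesis
        using step_off_crossing[OF long positive pts[OF p], of i] p by (simp add: s' n_def)
    qed
    have moves: "\<exists>p\<in>set (\<pi> (i - 1)). signed_pos n (\<pi> (i - 1)) p \<noteq> signed_pos n (\<pi> i) p"
      if e: "crossing_size d i = 0"
    proof -
      obtain x where x: "x \<in> points d" "point_height d x (i - 1) \<noteq> point_height d x i"
        using some_point_moves[OF long positive e] by blast
      obtain p where "p \<in> P" "idx p = x" using idx x(1) by (metis bij_betw_def imageE)
      then show ?thesis using x setP s by (intro bexI[of _ p]) auto
    qed
    have sets: "set (\<pi> (i - 1)) = set (\<pi> i)" using setP by simp
    show "switches (\<pi> (i - 1)) (\<pi> i) \<noteq> {}"
      "\<forall>b \<in> switches (\<pi> (i - 1)) (\<pi> i) - crossing_switches (\<pi> (i - 1)) (\<pi> i). length b = 2"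
      "crossing_switches (\<pi> (i - 1)) (\<pi> i) = {} \<longleftrightarrow> crossing_size d i = 0"
      "crossing_size d i \<noteq> 0 \<Longrightarrow>
        int (length (the_elem (crossing_switches (\<pi> (i - 1)) (\<pi> i))) div 2) = crossing_size d i"
      using *[OF sets side inner outer moves] by blast+
  qed
  have once: "\<exists>!i. i \<in> {1..int (2 * n)} \<and> (\<exists>b\<in>switches (\<pi> (i - 1)) (\<pi> i). p \<in> set b \<and> q \<in> set b)"
    if pq: "p \<in> P" "q \<in> P" "p \<noteq> q" for p q
  proof -
    have "idx p \<noteq> idx q" using bij_betw_imp_inj_on[OF idx] pq by (meson inj_onD)
    from pair_switches_once[OF long positive pts[OF pq(1)] pts[OF pq(2)] this]
    have "\<exists>!i. i \<in> {1..2 * int n} \<and>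
      (pos (\<pi> (i - 1)) p < pos (\<pi> (i - 1)) q) \<noteq> (pos (\<pi> i) p < pos (\<pi> i) q)"
      using pq by (simp add: s[symmetric] signed_pos_less n_def[symmetric])
    moreover have "(\<exists>b\<in>switches (\<pi> (i - 1)) (\<pi> i). p \<in> set b \<and> q \<in> set b) \<longleftrightarrow>
      (pos (\<pi> (i - 1)) p < pos (\<pi> (i - 1)) q) \<noteq> (pos (\<pi> i) p < pos (\<pi> i) q)" for i
      using switch_iff_order_reversed[OF dist move(1)] pq setP by metis
    ultimately show ?thesis by simp
  qed
  have allow: "allowable_with P \<pi> (2 * n)"
    unfolding allowable_with_def using fin perm n0 half move(1) once by simp
  have "\<exists>q\<in>P. \<forall>i. pos (\<pi> i) p + pos (\<pi> i) q = 2 * n + 1" if p: "p \<in> P" for p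
  proof -
    obtain i j where ij: "idx p = (i, j)" by (cases "idx p")
    define i' where "i' = (if i < length d then i + length d else i - length d)"
    have i: "i < 2 * length d" using pts[OF p] ij by (simp add: points_def)
    have i'': "i' = i + length d \<or> i = i' + length d" by (auto simp: i'_def)
    then have "i' mod length d = i mod length d" by auto
    then have "(i', j) \<in> points d" using pts[OF p] ij i by (auto simp: points_def i'_def)
    then obtain q where q: "q \<in> P" "idx q = (i', j)" using idx by (metis bij_betw_def imageE)
    have "point_height d (idx p) T = - point_height d (idx q) T" for T
      using i'' point_height_antiperiodic(2)[OF long positive] ij q(2) by auto
    then have "signed_pos n (\<pi> T) p = - signed_pos n (\<pi> T) q" for T using s p q(1) by simp
    then have "\<forall>T. pos (\<pi> T) p + pos (\<pi> T) q = 2 * n + 1" by (intro allI signed_pos_opposite)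
    then show ?thesis using q(1) by blast
  qed
  then have sym: "centrally_symmetric P \<pi>" using card unfolding centrally_symmetric_def by blast
  have h: "halfperiod_length P \<pi> = 2 * n" using halfperiod_length_eq[OF allow] .
  have "central_signature P \<pi> =
    map (\<lambda>i. length (the_elem (crossing_switches (\<pi> (i - 1)) (\<pi> i))) div 2)
      (map (crossing_time d) [0..<length d])"
    unfolding central_signature_def h using crossing_times_in_halfperiod move(3) by simp
  also have "\<dots> = map (\<lambda>i. d ! i) [0..<length d]"
    unfolding map_map
  proof (rule map_cong[OF refl])
    fix i assume i: "i \<in> set [0..<length d]"
    have c: "crossing_size d (crossing_time d i) = block_size d i"
      by (rule crossing_size_eq[OF long positive]) simp
    have ne: "block_size d i \<noteq> 0" using block_size_pos[OF positive, of i] long by fastforce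
    have "int (length (the_elem (crossing_switches (\<pi> (crossing_time d i - 1)) (\<pi> (crossing_time d i)))) div 2)
      = block_size d i"
      using move(4)[of "crossing_time d i"] c ne by simp
    then show "((\<lambda>i. length (the_elem (crossing_switches (\<pi> (i - 1)) (\<pi> i))) div 2) \<circ> crossing_time d) i = d ! i"
      using i by (simp add: block_size_def)
  qed
  also have "\<dots> = d" by (rule map_nth)
  finally have "has_central_signature P \<pi> d"
    unfolding has_central_signature_def by (intro exI[of _ 0]) simp
  moreover have "even_near_critical P \<pi>" using card h unfolding even_near_critical_def by blast
  moreover have "noncentral_general_position \<pi>"
    using move(2) unfolding noncentral_general_position_def by blast
  ultimately show ?thesis using allow sym unfolding realizes_def allowable_sequence_def by blast
qed

end

section \<open>Rigidity of central motions\<close>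

text \<open>
  Induction on time. If \<open>y j\<close> rises, then there has to be a gap of at least two to \<open>y (j + 1)\<close>, because
  an exchange of the two is excluded by \<open>blocked\<close>. So after the step it is at least one below the
  bound that \<open>y (j + 1)\<close> satisfied before the step, and this is the bound claimed.
\<close>

lemma spreading_bound:
  fixes y :: "int \<Rightarrow> nat \<Rightarrow> int"
  assumes start: "\<And>k. 1 \<le> k \<Longrightarrow> k \<le> d \<Longrightarrow> y k 0 = k"
    and step: "\<And>k s. 1 \<le> k \<Longrightarrow> k \<le> d \<Longrightarrow> Suc s < m \<Longrightarrow> \<bar>y k (Suc s) - y k s\<bar> \<le> 1"
    and order: "\<And>k s. 1 \<le> k \<Longrightarrow> k < d \<Longrightarrow> s < m \<Longrightarrow> y k s < y (k + 1) s"
    and blocked: "\<And>k s. 1 \<le> k \<Longrightarrow> k < d \<Longrightarrow> Suc s < m \<Longrightarrow>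
      y (k + 1) s = y k s + 1 \<Longrightarrow> y k (Suc s) \<noteq> y (k + 1) s"
    and j: "1 \<le> j" "j \<le> d" and s: "s < m"
  shows "y j s \<le> max j (2 * j - d + int s)"
  using j s
proof (induction s arbitrary: j)
  case 0
  then show ?case using start by simp
next
  case (Suc s)
  note IH = Suc.IH[OF _ _ Suc_lessD[OF Suc.prems(3)]]
  have st: "\<bar>y j (Suc s) - y j s\<bar> \<le> 1" using step Suc.prems by simp
  show ?case
  proof (cases "y j (Suc s) \<le> y j s \<or> j = d")
    case True
    then show ?thesis using IH[OF Suc.prems(1,2)] st by auto
  next
    case False
    then have up: "y j (Suc s) = y j s + 1" and jd: "j < d" using st Suc.prems by auto
    have "y (j + 1) s \<noteq> y j s + 1" using blocked[of j s] Suc.prems jd up by auto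
    then have "y j s + 2 \<le> y (j + 1) s" using order[of j s] Suc.prems jd by simp
    moreover have "y (j + 1) s \<le> max (j + 1) (2 * (j + 1) - d + int s)"
      using IH[of "j + 1"] Suc.prems jd by simp
    ultimately show ?thesis using up by simp
  qed
qed

text \<open>
  The properties of the heights \<open>G T\<close> and the crossing sizes \<open>e T\<close> of a sequence that rigidity depends
  on; the move number \<open>T\<close> leads from \<open>G (T - 1)\<close> to \<open>G T\<close>. Conjugate points occur only through
  \<open>sign_changes_once\<close>, which is the condition that they switch once.
\<close>

locale central_motion =
  fixes P :: "'a set" and G :: "int \<Rightarrow> 'a \<Rightarrow> int" and e :: "int \<Rightarrow> int" and n :: int
  assumes n_pos: "0 < n"
    and bij: "\<And>T. bij_betw (G T) P ({- n..n} - {0})"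
    and antiperiodic: "\<And>p T. p \<in> P \<Longrightarrow> G (T + 2 * n) p = - G T p"
    and size_bounds: "\<And>T. 0 \<le> e T \<and> e T \<le> n"
    and inner: "\<And>p T. p \<in> P \<Longrightarrow> \<bar>G (T - 1) p\<bar> \<le> e T \<Longrightarrow> G T p = - G (T - 1) p"
    and outer: "\<And>p T. p \<in> P \<Longrightarrow> e T < \<bar>G (T - 1) p\<bar> \<Longrightarrow>
      \<bar>G T p - G (T - 1) p\<bar> \<le> 1 \<and> (0 < G T p \<longleftrightarrow> 0 < G (T - 1) p)"
    and exchange: "\<And>p q T. p \<in> P \<Longrightarrow> q \<in> P \<Longrightarrow> G T p = G (T - 1) q \<Longrightarrow> G T q = G (T - 1) p"
    and order_changes_once: "\<And>p q T T'. p \<in> P \<Longrightarrow> q \<in> P \<Longrightarrow> p \<noteq> q \<Longrightarrow>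
      (G (T - 1) p < G (T - 1) q) \<noteq> (G T p < G T q) \<Longrightarrow>
      (G (T' - 1) p < G (T' - 1) q) \<noteq> (G T' p < G T' q) \<Longrightarrow> 2 * n dvd T - T'"
    and sign_changes_once: "\<And>p T T'. p \<in> P \<Longrightarrow>
      (0 < G (T - 1) p) \<noteq> (0 < G T p) \<Longrightarrow> (0 < G (T' - 1) p) \<noteq> (0 < G T' p) \<Longrightarrow> 2 * n dvd T - T'"
begin

lemma finite_P: "finite P"
  using bij_betw_finite[OF bij[of 0]] by simp

lemma height_range: "p \<in> P \<Longrightarrow> G T p \<noteq> 0 \<and> - n \<le> G T p \<and> G T p \<le> n"
  using bij_betwE[OF bij[of T]] by auto

lemma height_inj: "p \<in> P \<Longrightarrow> q \<in> P \<Longrightarrow> G T p = G T q \<Longrightarrow> p = q"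
  using bij_betw_imp_inj_on[OF bij[of T]] by (meson inj_onD)

lemma height_surj: "k \<noteq> 0 \<Longrightarrow> - n \<le> k \<Longrightarrow> k \<le> n \<Longrightarrow> \<exists>p\<in>P. G T p = k"
  using bij_betw_imp_surj_on[OF bij[of T]] by (metis (no_types, lifting) DiffI atLeastAtMost_iff imageE singletonD)

lemma sign_change_iff: "p \<in> P \<Longrightarrow> (0 < G (T - 1) p) \<noteq> (0 < G T p) \<longleftrightarrow> \<bar>G (T - 1) p\<bar> \<le> e T"
  using inner[of p T] outer[of p T] height_range[of p "T - 1"] by (cases "\<bar>G (T - 1) p\<bar> \<le> e T") auto

lemma not_dvd_short: "0 < i \<Longrightarrow> i < 2 * n \<Longrightarrow> \<not> 2 * n dvd i" for i
  using zdvd_not_zless by blast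

lemma constant_until:
  fixes B :: "int \<Rightarrow> bool"
  assumes "\<And>i. T < i \<Longrightarrow> i < T + 2 * n \<Longrightarrow> B (i - 1) = B i" "T \<le> U" "U < T + 2 * n"
  shows "B U = B T"
  using assms(2,3)
proof (induction U rule: int_ge_induct)
  case (step i)
  then show ?case using assms(1)[of "i + 1"] by simp
qed simp

lemma sign_after_crossing:
  assumes p: "p \<in> P" and change: "G (T - 1) p < 0" "0 < G T p" and U: "T \<le> U" "U < T + 2 * n"
  shows "0 < G U p"
proof -
  have "(0 < G U p) = (0 < G T p)"
  proof (rule constant_until[of T "\<lambda>i. 0 < G i p"])
    fix i assume i: "T < i" "i < T + 2 * n"
    show "(0 < G (i - 1) p) = (0 < G i p)"
    proof (rule ccontr)
      assume "(0 < G (i - 1) p) \<noteq> (0 < G i p)"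
      then have "2 * n dvd i - T" using sign_changes_once[OF p, of i T] change by auto
      then show False using not_dvd_short[of "i - T"] i by simp
    qed
  qed (use U in auto)
  then show ?thesis using change by simp
qed

lemma order_after_crossing:
  assumes pq: "p \<in> P" "q \<in> P" and change: "G (T - 1) q < G (T - 1) p" "G T p < G T q"
    and U: "T \<le> U" "U < T + 2 * n"
  shows "G U p < G U q"
proof -
  have ne: "p \<noteq> q" using change by auto
  have "(G U p < G U q) = (G T p < G T q)"
  proof (rule constant_until[of T "\<lambda>i. G i p < G i q"])
    fix i assume i: "T < i" "i < T + 2 * n"
    show "(G (i - 1) p < G (i - 1) q) = (G i p < G i q)"
    proof (rule ccontr)
      assume "(G (i - 1) p < G (i - 1) q) \<noteq> (G i p < G i q)"
      then have "2 * n dvd i - T" using order_changes_once[OF pq ne, of i T] change by auto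
      then show False using not_dvd_short[of "i - T"] i by simp
    qed
  qed (use U in auto)
  then show ?thesis using change by simp
qed

lemma size_periodic: "e (T + 2 * n) = e T"
proof -
  have le: "e T \<le> e U" if TU: "U = T + 2 * n \<or> T = U + 2 * n" for T U
  proof (cases "e T = 0")
    case False
    then obtain p where p: "p \<in> P" "G (T - 1) p = e T"
      using height_surj[of "e T" "T - 1"] size_bounds[of T] n_pos by auto
    have U: "G (U - 1) p = - G (T - 1) p \<and> G U p = - G T p"
      using TU antiperiodic[OF p(1), of "T - 1"] antiperiodic[OF p(1), of "U - 1"]
        antiperiodic[OF p(1), of T] antiperiodic[OF p(1), of U] by (auto simp: algebra_simps)
    have "(0 < G (T - 1) p) \<noteq> (0 < G T p)" using sign_change_iff[OF p(1), of T] p(2) size_bounds[of T] by simp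
    then have "(0 < G (U - 1) p) \<noteq> (0 < G U p)"
      using U height_range[OF p(1), of T] height_range[OF p(1), of "T - 1"] by auto
    then show ?thesis using sign_change_iff[OF p(1), of U] U p(2) size_bounds[of T] by simp
  qed (use size_bounds in simp)
  show ?thesis using le[of "T + 2 * n" T] le[of T "T + 2 * n"] by simp
qed

text \<open>
  Every point changes sign in some move of a halfperiod, and a move with crossing size \<open>e T\<close> changes the
  sign of at most \<open>2 e T\<close> points.
\<close>

lemma total_size: "n \<le> (\<Sum>T\<in>{1..2 * n}. e T)"
proof -
  define Q where "Q T = {p \<in> P. \<bar>G (T - 1) p\<bar> \<le> e T}" for T
  have "P \<subseteq> (\<Union>T\<in>{1..2 * n}. Q T)"
  proof
    fix p assume p: "p \<in> P"
    show "p \<in> (\<Union>T\<in>{1..2 * n}. Q T)"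
    proof (rule ccontr)
      assume "\<not> ?thesis"
      then have no: "(0 < G (i - 1) p) = (0 < G i p)" if "0 < i" "i \<le> 2 * n" for i
        using that sign_change_iff[OF p, of i] p by (auto simp: Q_def)
      have "(0 < G (2 * n - 1) p) = (0 < G 0 p)"
        by (rule constant_until[of 0 "\<lambda>i. 0 < G i p"]) (use no n_pos in auto)
      then have "(0 < G (0 + 2 * n) p) = (0 < G 0 p)" using no[of "2 * n"] n_pos by simp
      then show False using antiperiodic[OF p, of 0] height_range[OF p, of 0] by auto
    qed
  qed
  then have "card P \<le> card (\<Union>T\<in>{1..2 * n}. Q T)"
    using finite_P by (intro card_mono) (auto simp: Q_def)
  also have "\<dots> \<le> (\<Sum>T\<in>{1..2 * n}. card (Q T))" by (intro card_UN_le) simp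
  finally have "int (card P) \<le> (\<Sum>T\<in>{1..2 * n}. int (card (Q T)))"
    by (metis of_nat_le_iff of_nat_sum)
  also have "\<dots> \<le> (\<Sum>T\<in>{1..2 * n}. 2 * e T)"
  proof (rule sum_mono)
    fix T
    have "card (Q T) \<le> card ({- e T..e T} - {0})"
    proof (rule card_inj_on_le)
      show "inj_on (G (T - 1)) (Q T)" using height_inj by (auto simp: inj_on_def Q_def)
      show "G (T - 1) ` Q T \<subseteq> {- e T..e T} - {0}" using height_range by (auto simp: Q_def)
    qed simp
    also have "card ({- e T..e T} - {0}) = nat (2 * e T)" using size_bounds[of T] by simp
    finally show "int (card (Q T)) \<le> 2 * e T" using size_bounds[of T] by linarith
  qed
  also have "\<dots> = 2 * (\<Sum>T\<in>{1..2 * n}. e T)" by (simp add: sum_distrib_left)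
  finally have "int (card P) \<le> 2 * (\<Sum>T\<in>{1..2 * n}. e T)" .
  moreover have "card P = nat (2 * n)" using bij_betw_same_card[OF bij[of 0]] n_pos by simp
  ultimately show ?thesis using n_pos by simp
qed

context
  fixes T :: int and X :: "int \<Rightarrow> 'a"
  defines "X k \<equiv> inv_into P (G T) k"
begin

lemma crossing_point:
  assumes "1 \<le> k" "k \<le> e T"
  shows "X k \<in> P" "G T (X k) = k" "G (T - 1) (X k) = - k"
proof -
  have k: "k \<in> G T ` P"
    using assms size_bounds[of T] bij_betw_imp_surj_on[OF bij[of T]] by auto
  then show X: "X k \<in> P" "G T (X k) = k" unfolding X_def by (auto intro: inv_into_into f_inv_into_f)
  obtain q where q: "q \<in> P" "G (T - 1) q = - k"
    using height_surj[of "- k" "T - 1"] assms size_bounds[of T] by auto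
  then have "G T q = k" using inner[OF q(1), of T] assms by simp
  then have "q = X k" using height_inj q(1) X by metis
  then show "G (T - 1) (X k) = - k" using q by simp
qed

lemma crossing_point_positive:
  assumes "1 \<le> k" "k \<le> e T" "T \<le> U" "U < T + 2 * n"
  shows "0 < G U (X k)"
  using sign_after_crossing[of "X k" T U] crossing_point[OF assms(1,2)] assms by simp

lemma crossing_point_step:
  assumes "1 \<le> k" "k \<le> e T" "T < U" "U < T + 2 * n"
  shows "\<bar>G U (X k) - G (U - 1) (X k)\<bar> \<le> 1"
proof -
  have "0 < G U (X k)" "0 < G (U - 1) (X k)" using crossing_point_positive assms by simp_all
  then have "e U < \<bar>G (U - 1) (X k)\<bar>"
    using sign_change_iff[OF crossing_point(1)[OF assms(1,2)], of U] by linarith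
  then show ?thesis using outer[OF crossing_point(1)[OF assms(1,2)], of U] by simp
qed

lemma crossing_points_order:
  assumes "1 \<le> k" "k < l" "l \<le> e T" "T \<le> U" "U < T + 2 * n"
  shows "G U (X k) < G U (X l)"
  using order_after_crossing[of "X k" "X l" T U] crossing_point[of k] crossing_point[of l] assms by simp

lemma forward_bound:
  assumes j: "1 \<le> j" "j \<le> e T" and s: "int s < 2 * n"
  shows "G (T + int s) (X j) \<le> max j (2 * j - e T + int s)"
proof (rule spreading_bound[of "e T" "\<lambda>k s. G (T + int s) (X k)" "nat (2 * n)"])
  fix k s assume k: "1 \<le> k" "k < e T" and s: "Suc s < nat (2 * n)"
    and next_to: "G (T + int s) (X (k + 1)) = G (T + int s) (X k) + 1"
  show "G (T + int (Suc s)) (X k) \<noteq> G (T + int s) (X (k + 1))"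
  proof
    assume "G (T + int (Suc s)) (X k) = G (T + int s) (X (k + 1))"
    then have "G (T + int (Suc s)) (X (k + 1)) = G (T + int s) (X k)"
      using exchange[of "X k" "X (k + 1)" "T + int (Suc s)"] crossing_point(1) k by simp
    moreover have "G (T + int (Suc s)) (X k) < G (T + int (Suc s)) (X (k + 1))"
      using k s by (intro crossing_points_order) auto
    ultimately show False using next_to \<open>G (T + int (Suc s)) (X k) = G (T + int s) (X (k + 1))\<close> by simp
  qed
next
  fix k s assume "1 \<le> k" "k \<le> e T" "Suc s < nat (2 * n)"
  then show "\<bar>G (T + int (Suc s)) (X k) - G (T + int s) (X k)\<bar> \<le> 1"
    using crossing_point_step[of k "T + int (Suc s)"] by simp
next
  fix k s assume "1 \<le> k" "k < e T" "s < nat (2 * n)"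
  then show "G (T + int s) (X k) < G (T + int s) (X (k + 1))"
    by (intro crossing_points_order) auto
qed (use crossing_point(2) j s in auto)

text \<open>
  The lemma \<open>spreading_bound\<close> for the reversed motion: the same points are at heights \<open>1, \<dots>, e T\<close>
  just before they cross again in the move \<open>T + 2 n\<close>.
\<close>

lemma backward_bound:
  assumes j: "1 \<le> j" "j \<le> e T" and s: "int s < 2 * n"
  shows "G (T + 2 * n - 1 - int s) (X j) \<le> max j (2 * j - e T + int s)"
proof (rule spreading_bound[of "e T" "\<lambda>k s. G (T + 2 * n - 1 - int s) (X k)" "nat (2 * n)"])
  fix k assume k: "1 \<le> k" "k \<le> e T"
  then have "G (T - 1 + 2 * n) (X k) = - G (T - 1) (X k)"
    using antiperiodic crossing_point(1) by blast
  then show "G (T + 2 * n - 1 - int 0) (X k) = k" using crossing_point(3)[OF k] by (simp add: algebra_simps)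
next
  fix k s assume k: "1 \<le> k" "k < e T" and s: "Suc s < nat (2 * n)"
    and next_to: "G (T + 2 * n - 1 - int s) (X (k + 1)) = G (T + 2 * n - 1 - int s) (X k) + 1"
  let ?U = "T + 2 * n - 1 - int s"
  have U: "?U - 1 = T + 2 * n - 1 - int (Suc s)" by simp
  show "G (T + 2 * n - 1 - int (Suc s)) (X k) \<noteq> G ?U (X (k + 1))"
  proof
    assume eq: "G (T + 2 * n - 1 - int (Suc s)) (X k) = G ?U (X (k + 1))"
    then have "G ?U (X k) = G (?U - 1) (X (k + 1))"
      using exchange[of "X (k + 1)" "X k" ?U] crossing_point(1) k unfolding U by simp
    moreover have "G (?U - 1) (X k) < G (?U - 1) (X (k + 1))"
      using k s by (intro crossing_points_order) auto
    ultimately show False using next_to eq unfolding U by simp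
  qed
next
  fix k s assume "1 \<le> k" "k \<le> e T" "Suc s < nat (2 * n)"
  then show "\<bar>G (T + 2 * n - 1 - int (Suc s)) (X k) - G (T + 2 * n - 1 - int s) (X k)\<bar> \<le> 1"
    using crossing_point_step[of k "T + 2 * n - 1 - int s"] by (simp add: abs_minus_commute algebra_simps)
next
  fix k s assume "1 \<le> k" "k < e T" "s < nat (2 * n)"
  then show "G (T + 2 * n - 1 - int s) (X k) < G (T + 2 * n - 1 - int s) (X (k + 1))"
    by (intro crossing_points_order) auto
qed (use j s in auto)

lemma top_bound:
  assumes j: "1 \<le> j" "j \<le> e T" and U: "T \<le> U" "U < T + 2 * n"
  shows "G U (X j) \<le> n - e T + j"
  using j(2,1)
proof (induction j rule: int_le_induct)
  case base
  then show ?case using height_range[OF crossing_point(1)] by simp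
next
  case (step i)
  then have "G U (X (i - 1)) < G U (X i)" using U by (intro crossing_points_order) auto
  then show ?case using step by simp
qed

lemma profile_bound:
  assumes j: "1 \<le> j" "j \<le> e T" and s: "0 \<le> s" "s < 2 * n"
  shows "G (T + s) (X j) \<le> profile n (e T) j s"
proof -
  have "G (T + s) (X j) \<le> max j (2 * j - e T + s)"
    using forward_bound[OF j, of "nat s"] s by simp
  moreover have "G (T + s) (X j) \<le> max j (2 * j - e T + (2 * n - 1 - s))"
    using backward_bound[OF j, of "nat (2 * n - 1 - s)"] s by simp
  moreover have "G (T + s) (X j) \<le> n - e T + j" using top_bound[OF j, of "T + s"] s by simp
  ultimately show ?thesis unfolding profile_def by linarith
qed

end

text \<open>
  The point that leaves the first crossing switch at height 1 does not take part in the second one,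
  so it is then above height \<open>e T'\<close>. By \<open>forward_bound\<close> it needs \<open>e T - 1\<close> moves before it can
  start, and then \<open>e T'\<close> more.
\<close>

lemma crossing_gap:
  assumes "0 < e T" "0 < e T'" "T < T'" "T' < T + 2 * n"
  shows "e T + e T' \<le> T' - T"
proof -
  let ?x = "inv_into P (G T) 1"
  have x: "?x \<in> P" using crossing_point(1)[where k = 1 and T = T] assms(1) by simp
  have "G (T' - 1) ?x \<le> max 1 (2 - e T + (T' - 1 - T))"
    using forward_bound[where T = T and j = 1 and s = "nat (T' - 1 - T)"] assms by simp
  moreover have "0 < G (T' - 1) ?x" "0 < G T' ?x"
    using crossing_point_positive[where T = T and k = 1] assms by simp_all
  then have "e T' < \<bar>G (T' - 1) ?x\<bar>" using sign_change_iff[OF x, of T'] by linarith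
  ultimately show ?thesis using \<open>0 < G (T' - 1) ?x\<close> assms(2) by linarith
qed

end

lemma sum_list_rotate: "sum_list (rotate k xs) = sum_list (xs :: nat list)"
proof (induction k)
  case (Suc k)
  have "sum_list (rotate1 ys) = sum_list ys" for ys :: "nat list" by (cases ys) auto
  then show ?case using Suc by simp
qed simp

lemma sum_positive_values:
  fixes f :: "'a \<Rightarrow> int"
  assumes "bij_betw f X ({- n..n} - {0})"
  shows "(\<Sum>x\<in>{x \<in> X. 0 < f x}. f x) = (\<Sum>k\<in>{1..n}. k)"
proof -
  have "f ` {x \<in> X. 0 < f x} = {1..n}"
  proof
    show "f ` {x \<in> X. 0 < f x} \<subseteq> {1..n}" using bij_betwE[OF assms] by fastforce
    show "{1..n} \<subseteq> f ` {x \<in> X. 0 < f x}"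
    proof
      fix k assume k: "k \<in> {1..n}"
      then have "k \<in> f ` X" using bij_betw_imp_surj_on[OF assms] by auto
      then show "k \<in> f ` {x \<in> X. 0 < f x}" using k by auto
    qed
  qed
  moreover have "inj_on f {x \<in> X. 0 < f x}"
    using bij_betw_imp_inj_on[OF assms] by (rule inj_on_subset) auto
  ultimately have "bij_betw f {x \<in> X. 0 < f x} {1..n}" by (simp add: bij_betw_def)
  then show ?thesis by (rule sum.reindex_bij_betw)
qed

context central_motion
begin

text \<open>
  By \<open>crossing_gap\<close>, the differences between the actual and the prescribed crossing times are
  nondecreasing. After a full turn the difference has grown by \<open>2 (n - sum_list d)\<close>, which is not
  positive, so it is constant.
\<close>

lemma crossing_times_forced:
  assumes long: "length d > 1" and positive: "\<forall>x\<in>set d. 0 < x"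
    and le: "n \<le> int (sum_list d)"
    and periodic: "\<And>i. ct (i + length d) = ct i + 2 * n"
    and size: "\<And>i. e (ct i) = block_size d i"
    and increasing: "\<And>i. ct i < ct (Suc i)" "\<And>i. ct (Suc i) < ct i + 2 * n"
  shows "n = int (sum_list d)" and "\<exists>m. \<forall>i. ct i = crossing_time d i + m"
proof -
  define \<delta> where "\<delta> i = ct i - crossing_time d i" for i
  have pos: "0 < block_size d i" for i using block_size_pos[OF positive, of i] long by fastforce
  have "\<delta> i \<le> \<delta> (Suc i)" for i
    using crossing_gap[of "ct i" "ct (Suc i)"] pos increasing
    by (simp add: size \<delta>_def crossing_time_Suc)
  then have mono: "i \<le> j \<Longrightarrow> \<delta> i \<le> \<delta> j" for i j by (rule lift_Suc_mono_le)
  have shift: "\<delta> (i + length d) = \<delta> i + 2 * (n - int (sum_list d))" for i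
    by (simp add: \<delta>_def periodic crossing_time_add)
  show n: "n = int (sum_list d)" using mono[of 0 "0 + length d"] le unfolding shift by simp
  have multiple: "\<delta> (k * length d) = \<delta> 0" for k
  proof (induction k)
    case (Suc k)
    then show ?case using shift[of "k * length d"] n by (simp add: add.commute)
  qed simp
  have "\<delta> i = \<delta> 0" for i
  proof (rule antisym)
    have "i \<le> i * length d" using long by simp
    then show "\<delta> i \<le> \<delta> 0" using mono multiple by metis
  qed (rule mono, simp)
  then have "\<forall>i. ct i = crossing_time d i + \<delta> 0" by (metis \<delta>_def diff_eq_eq add.commute)
  then show "\<exists>m. \<forall>i. ct i = crossing_time d i + m" ..
qed

text \<open>
  The \<open>i\<close>-th crossing time counts from the crossing switch that is listed first in the rotated
  signature, and is continued periodically.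
\<close>

lemma crossing_times_of_signature:
  assumes long: "length d > 1"
    and sig: "d = rotate k (map (\<lambda>i. nat (e i)) (filter (\<lambda>i. e i \<noteq> 0) [1..2 * n]))"
  shows "int (sum_list d) = (\<Sum>T\<in>{1..2 * n}. e T)"
    and "\<exists>ct. (\<forall>i. ct (i + length d) = ct i + 2 * n) \<and> (\<forall>i. e (ct i) = block_size d i) \<and>
      (\<forall>i. ct i < ct (Suc i) \<and> ct (Suc i) < ct i + 2 * n)"
proof -
  define cs where "cs = filter (\<lambda>i. e i \<noteq> 0) [1..2 * n]"
  let ?t = "length d"
  have d: "d = rotate k (map (\<lambda>i. nat (e i)) cs)" using sig by (simp add: cs_def)
  have t: "length cs = ?t" by (subst d) simp
  have t0: "0 < ?t" using long by linarith
  have "sum_list d = sum_list (map (\<lambda>i. nat (e i)) cs)" by (subst d) (rule sum_list_rotate)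
  also have "\<dots> = (\<Sum>T\<in>set cs. nat (e T))"
    by (rule sum_list_distinct_conv_sum_set) (simp add: cs_def)
  also have "\<dots> = (\<Sum>T\<in>{1..2 * n}. nat (e T))"
    by (rule sum.mono_neutral_left) (auto simp: cs_def)
  finally show "int (sum_list d) = (\<Sum>T\<in>{1..2 * n}. e T)"
    using size_bounds by (simp add: int_sum[symmetric] of_nat_sum)
  define ct where "ct i = cs ! ((i + k) mod ?t) + 2 * n * int ((i + k) div ?t)" for i
  have r: "(i + k) mod ?t < length cs" for i using t t0 by simp
  have sorted: "sorted_wrt (<) cs" unfolding cs_def by (intro sorted_wrt_filter) (simp add: sorted_wrt_upto)
  have less: "cs ! i < cs ! j" if "i < j" "j < ?t" for i j
    using sorted_wrt_nth_less[OF sorted, of i j] that t by simp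
  have range: "1 \<le> cs ! i \<and> cs ! i \<le> 2 * n" if "i < ?t" for i
  proof -
    have "cs ! i \<in> set cs" using that t by simp
    then show ?thesis by (auto simp: cs_def)
  qed
  have "ct (i + ?t) = ct i + 2 * n" for i
  proof -
    have "(i + ?t + k) mod ?t = (i + k) mod ?t" "(i + ?t + k) div ?t = (i + k) div ?t + 1"
      using t0 by (simp_all add: add.assoc add.commute[of _ k] div_add_self1 flip: add.assoc)
    then show ?thesis by (simp add: ct_def algebra_simps)
  qed
  moreover have "e (ct i) = block_size d i" for i
  proof -
    have "e (ct i) = e (cs ! ((i + k) mod ?t))"
      unfolding ct_def by (rule periodic_shift[of e, OF size_periodic])
    also have "\<dots> = int (map (\<lambda>i. nat (e i)) cs ! ((i + k) mod ?t))"
      using r size_bounds by simp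
    also have "map (\<lambda>i. nat (e i)) cs ! ((i + k) mod ?t) = d ! (i mod ?t)"
    proof -
      have "d ! (i mod ?t) = rotate k (map (\<lambda>i. nat (e i)) cs) ! (i mod ?t)" using d by simp
      also have "\<dots> = map (\<lambda>i. nat (e i)) cs ! ((k + i mod ?t) mod ?t)"
        using t t0 by (subst nth_rotate) simp_all
      also have "(k + i mod ?t) mod ?t = (i + k) mod ?t" by (simp add: mod_simps add.commute)
      finally show ?thesis by simp
    qed
    finally show ?thesis by (simp add: block_size_def)
  qed
  moreover have "ct i < ct (Suc i) \<and> ct (Suc i) < ct i + 2 * n" for i
  proof (cases "Suc ((i + k) mod ?t) < ?t")
    case True
    then have "(Suc i + k) mod ?t = Suc ((i + k) mod ?t)" "(Suc i + k) div ?t = (i + k) div ?t"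
      by (simp_all add: mod_Suc div_Suc)
    then show ?thesis using less[OF _ True, of "(i + k) mod ?t"] range[OF True] range[of "(i + k) mod ?t"] t0
      by (simp add: ct_def)
  next
    case False
    then have last: "Suc ((i + k) mod ?t) = ?t" using t0 by (metis Suc_lessI mod_less_divisor)
    then have "(Suc i + k) mod ?t = 0" "(Suc i + k) div ?t = (i + k) div ?t + 1"
      by (simp_all add: mod_Suc div_Suc)
    moreover have "cs ! 0 < cs ! ((i + k) mod ?t)" using less[of 0 "(i + k) mod ?t"] last long by simp
    ultimately show ?thesis using range[of 0] range[of "(i + k) mod ?t"] t0
      by (simp add: ct_def algebra_simps)
  qed
  ultimately show "\<exists>ct. (\<forall>i. ct (i + length d) = ct i + 2 * n) \<and> (\<forall>i. e (ct i) = block_size d i) \<and>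
      (\<forall>i. ct i < ct (Suc i) \<and> ct (Suc i) < ct i + 2 * n)" by blast
qed

text \<open>
  Label a point by the crossing switch in which it becomes positive and its height after it. Where
  the prescribed height is positive, the actual one is positive and not larger. Both families take
  the values \<open>1, \<dots>, n\<close> once each, so they have equal sums and agree. Negative heights follow by
  shifting time by \<open>2 n\<close>.
\<close>

theorem heights_determined:
  assumes long: "length d > 1" and positive: "\<forall>x\<in>set d. 0 < x"
    and sig: "d = rotate k (map (\<lambda>i. nat (e i)) (filter (\<lambda>i. e i \<noteq> 0) [1..2 * n]))"
  shows "n = int (sum_list d)"
    and "\<exists>idx m. bij_betw idx P (points d) \<and>
      (\<forall>T. \<forall>p\<in>P. G (T + m) p = point_height d (idx p) T)"
proof -
  obtain ct where ct: "\<And>i. ct (i + length d) = ct i + 2 * n" "\<And>i. e (ct i) = block_size d i"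
    "\<And>i. ct i < ct (Suc i)" "\<And>i. ct (Suc i) < ct i + 2 * n"
    using crossing_times_of_signature(2)[OF long sig] by blast
  have le: "n \<le> int (sum_list d)"
    using crossing_times_of_signature(1)[OF long sig] total_size by simp
  show n: "n = int (sum_list d)"
    using crossing_times_forced(1)[OF long positive le, of ct] ct by blast
  obtain m where m: "\<And>i. ct i = crossing_time d i + m"
    using crossing_times_forced(2)[OF long positive le, of ct] ct by blast
  note anti = point_height_antiperiodic(1)[OF long positive, folded n]
  define pt where "pt x = inv_into P (G (ct (fst x))) (int (snd x))" for x
  have j: "1 \<le> int (snd x)" "int (snd x) \<le> e (ct (fst x))" if "x \<in> points d" for x
    using point_ranges[OF long positive that] ct(2) by simp_all
  have pt: "pt x \<in> P" "G (ct (fst x)) (pt x) = int (snd x)" if "x \<in> points d" for x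
    unfolding pt_def using crossing_point[OF j[OF that]] by simp_all
  have upper: "0 < G (T + m) (pt x) \<and> G (T + m) (pt x) \<le> point_height d x T"
    if x: "x \<in> points d" and h: "0 < point_height d x T" for x T
  proof -
    let ?c = "crossing_time d (fst x)"
    define q where "q = (T - ?c) div (2 * n)"
    define s where "s = (T - ?c) mod (2 * n)"
    have s: "0 \<le> s" "s < 2 * n" using n_pos by (simp_all add: s_def)
    have "T - ?c = s + 2 * n * q" by (simp add: s_def q_def)
    have "point_height d x T = (if even q then 1 else - 1) * profile n (block_size d (fst x)) (int (snd x)) s"
      by (simp add: point_height_def height_def q_def s_def n)
    moreover have "1 \<le> profile n (block_size d (fst x)) (int (snd x)) s"
      using profile_bounds point_ranges[OF long positive x] unfolding n by blast
    ultimately have "even q" and hs: "point_height d x T = profile n (block_size d (fst x)) (int (snd x)) s"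
      using h by (auto split: if_splits)
    then obtain r where r: "q = 2 * r" by (auto elim: evenE)
    \<comment> \<open>The height is positive only if an even number of halfperiods has passed since the crossing.\<close>
    have "T + m = ct (fst x) + s + (4 * n) * r"
      using \<open>T - ?c = s + 2 * n * q\<close> m[of "fst x"] r by simp
    moreover have "G (U + 4 * n) (pt x) = G U (pt x)" for U
      using antiperiodic[OF pt(1)[OF x], of U] antiperiodic[OF pt(1)[OF x], of "U + 2 * n"]
      by (simp add: algebra_simps)
    then have "G (U + 4 * n * r) (pt x) = G U (pt x)" for U r
      by (rule periodic_shift[of "\<lambda>U. G U (pt x)"])
    ultimately have "G (T + m) (pt x) = G (ct (fst x) + s) (pt x)" by simp
    moreover have "0 < G (ct (fst x) + s) (pt x)"
      unfolding pt_def using crossing_point_positive[OF j[OF x]] s by simp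
    moreover have "G (ct (fst x) + s) (pt x) \<le> profile n (e (ct (fst x))) (int (snd x)) s"
      unfolding pt_def using profile_bound[OF j[OF x] s] .
    ultimately show ?thesis using hs ct(2) by simp
  qed
  have sign: "0 < G (T + m) (pt x) \<longleftrightarrow> 0 < point_height d x T" if x: "x \<in> points d" for x T
  proof (cases "0 < point_height d x T")
    case False
    moreover have "point_height d x T \<noteq> 0"
      using bij_betwE[OF point_height_bij[OF long positive, of T]] x by blast
    ultimately have "0 < G (T + 2 * n + m) (pt x)" using upper[OF x, of "T + 2 * n"] anti by simp
    moreover have "G (T + 2 * n + m) (pt x) = - G (T + m) (pt x)"
      using antiperiodic[OF pt(1)[OF x], of "T + m"] by (simp add: algebra_simps)
    ultimately show ?thesis using False by simp
  qed (use upper[OF x] in simp)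
  have inj: "inj_on pt (points d)"
  proof (rule inj_onI)
    fix x y assume x: "x \<in> points d" and y: "y \<in> points d" and eq: "pt x = pt y"
    let ?T = "crossing_time d (fst x)"
    have same: "0 < point_height d x T \<longleftrightarrow> 0 < point_height d y T" for T
      using sign[OF x, of T] sign[OF y, of T] eq by simp
    have hx: "point_height d x ?T = int (snd x)"
    proof -
      have "\<bar>point_height d x (?T - 1)\<bar> = int (snd x)" "point_height d x ?T = - point_height d x (?T - 1)"
        using step_at_crossing[OF long positive x, of ?T] by simp_all
      moreover have "0 < point_height d x ?T"
        using sign[OF x, of ?T] pt(2)[OF x] j(1)[OF x] by (simp add: m)
      ultimately show ?thesis by simp
    qed
    have "0 < point_height d y ?T" "\<not> 0 < point_height d y (?T - 1)"
      using same[of ?T] same[of "?T - 1"] hx step_at_crossing(2)[OF long positive x, of ?T] j(1)[OF x] by simp_all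
    then have dvd: "2 * n dvd ?T - crossing_time d (fst y)"
      using step_off_crossing(2)[OF long positive y, of ?T] n by auto
    have hy: "point_height d y ?T = int (snd y)"
      using step_at_crossing[OF long positive y, of ?T] dvd \<open>0 < point_height d y ?T\<close> n by simp
    obtain r where "?T = crossing_time d (fst y) + 2 * n * r"
      using dvd by (metis dvdE diff_eq_eq add.commute)
    then have "ct (fst x) = ct (fst y) + 2 * n * r" by (simp add: m)
    moreover have "\<bar>G (U + 2 * n * r) (pt y)\<bar> = \<bar>G U (pt y)\<bar>" for U
      by (rule periodic_shift[of "\<lambda>U. \<bar>G U (pt y)\<bar>"]) (simp add: antiperiodic[OF pt(1)[OF y]])
    ultimately have "\<bar>G (ct (fst x)) (pt y)\<bar> = \<bar>G (ct (fst y)) (pt y)\<bar>" by simp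
    then have "snd x = snd y" using pt(2)[OF x] pt(2)[OF y] eq by simp
    then have "point_height d x ?T = point_height d y ?T" using hx hy by simp
    then show "x = y" using inj_onD[OF point_height_inj[OF long positive]] x y by blast
  qed
  have bij_pt: "bij_betw pt (points d) P"
  proof -
    have "card P = nat (2 * n)" using bij_betw_same_card[OF bij[of 0]] n_pos by simp
    then have "card (pt ` points d) = card P" using card_image[OF inj] card_points n by simp
    then have "pt ` points d = P" using pt(1) finite_P by (intro card_subset_eq) auto
    then show ?thesis using inj by (simp add: bij_betw_def)
  qed
  have positive_eq: "G (T + m) (pt x) = point_height d x T"
    if x: "x \<in> points d" and h: "0 < point_height d x T" for x T
  proof (rule sum_mono_inv[where I = "{x \<in> points d. 0 < point_height d x T}"])
    let ?A = "{x \<in> points d. 0 < point_height d x T}"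
    have "(\<Sum>x\<in>{x \<in> points d. 0 < G (T + m) (pt x)}. G (T + m) (pt x)) = (\<Sum>k\<in>{1..n}. k)"
      using sum_positive_values[OF bij_betw_trans[OF bij_pt bij[of "T + m"]]] by simp
    moreover have "{x \<in> points d. 0 < G (T + m) (pt x)} = ?A" using sign by blast
    moreover have "(\<Sum>x\<in>?A. point_height d x T) = (\<Sum>k\<in>{1..n}. k)"
      by (rule sum_positive_values) (use point_height_bij[OF long positive] n in simp)
    ultimately show "(\<Sum>x\<in>?A. G (T + m) (pt x)) = (\<Sum>x\<in>?A. point_height d x T)" by simp
  qed (use upper x h finite_points in auto)
  have eq: "G (T + m) (pt x) = point_height d x T" if x: "x \<in> points d" for x T
  proof (cases "0 < point_height d x T")
    case False
    moreover have "point_height d x T \<noteq> 0"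
      using bij_betwE[OF point_height_bij[OF long positive, of T]] x by blast
    ultimately have "G (T + 2 * n + m) (pt x) = - point_height d x T"
      using positive_eq[OF x, of "T + 2 * n"] anti by simp
    moreover have "G (T + 2 * n + m) (pt x) = - G (T + m) (pt x)"
      using antiperiodic[OF pt(1)[OF x], of "T + m"] by (simp add: algebra_simps)
    ultimately show ?thesis by simp
  qed (use positive_eq[OF x] in simp)
  show "\<exists>idx m. bij_betw idx P (points d) \<and> (\<forall>T. \<forall>p\<in>P. G (T + m) p = point_height d (idx p) T)"
  proof (intro exI conjI allI ballI)
    show "bij_betw (inv_into (points d) pt) P (points d)" by (rule bij_betw_inv_into[OF bij_pt])
    fix T p assume p: "p \<in> P"
    then have "p \<in> pt ` points d" using bij_betw_imp_surj_on[OF bij_pt] by simp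
    then have "inv_into (points d) pt p \<in> points d" "pt (inv_into (points d) pt p) = p"
      by (simp_all add: inv_into_into f_inv_into_f)
    then show "G (T + m) p = point_height d (inv_into (points d) pt p) T"
      using eq[of "inv_into (points d) pt p" T] by simp
  qed
qed

end

section \<open>From sequences to heights, and back\<close>

text \<open>
  The entry of the central signature for a move, or 0 if the move contains no crossing switch.
\<close>

definition crossing_half :: "'a list \<Rightarrow> 'a list \<Rightarrow> nat"
  where "crossing_half xs ys =
    (if crossing_switches xs ys = {} then 0 else length (the_elem (crossing_switches xs ys)) div 2)"

text \<open>
  A switch of two points that is not centred has both its places on the same side of the centre, so
  it preserves signs.
\<close>

lemma central_move_heights:
  assumes dist: "distinct xs" and len: "length xs = 2 * n"
    and sw: "switches xs ys \<noteq> {}"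
    and short: "\<forall>b \<in> switches xs ys - crossing_switches xs ys. length b = 2"
  shows "crossing_half xs ys \<le> n"
    and "crossing_switches xs ys \<noteq> {} \<Longrightarrow> crossing_half xs ys \<noteq> 0"
    and "p \<in> set xs \<Longrightarrow> \<bar>signed_pos n xs p\<bar> \<le> int (crossing_half xs ys) \<Longrightarrow>
      signed_pos n ys p = - signed_pos n xs p"
    and "p \<in> set xs \<Longrightarrow> int (crossing_half xs ys) < \<bar>signed_pos n xs p\<bar> \<Longrightarrow>
      \<bar>signed_pos n ys p - signed_pos n xs p\<bar> \<le> 1 \<and> (0 < signed_pos n ys p \<longleftrightarrow> 0 < signed_pos n xs p)"
proof -
  let ?e = "crossing_half xs ys"
  obtain bs where bs: "reverses_blocks bs xs ys" using sw by (auto simp: switches_def)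
  have cross: "length M = 2 * ?e \<and> 1 \<le> ?e \<and> ?e \<le> n \<and>
      (\<forall>p\<in>set xs. p \<in> set M \<longleftrightarrow> n - ?e < pos xs p \<and> pos xs p \<le> n + ?e) \<and>
      (\<forall>p\<in>set M. pos xs p + pos ys p = 2 * n + 1)"
    if M: "M \<in> crossing_switches xs ys" for M
  proof -
    have "crossing_switches xs ys = {M}" using crossing_switches_unique[OF dist M] M by blast
    then have e: "?e = length M div 2" by (simp add: crossing_half_def)
    have "M \<in> set bs" "2 \<le> length M" "centered_substring xs M"
      using M reverses_blocks_unique[OF dist bs] by (auto simp: crossing_switches_def switches_def)
    then obtain a where a: "a + length M \<le> length xs"
      "\<And>p. p \<in> set xs \<Longrightarrow> p \<in> set M \<longleftrightarrow> a < pos xs p \<and> pos xs p \<le> a + length M"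
      "2 * a + length M = length xs"
      using block_positions[OF dist bs] by metis
    have "length M = 2 * ?e" using a(3) len unfolding e by presburger
    then have "a = n - ?e" "a + length M = n + ?e" "?e \<le> n" using a(3) len by linarith+
    then show ?thesis using a(2) \<open>length M = 2 * ?e\<close> \<open>2 \<le> length M\<close> len
        crossing_switch_pos[OF dist M] by (simp add: add.commute)
  qed
  show "?e \<le> n"
    using cross by (cases "crossing_switches xs ys = {}") (auto simp: crossing_half_def)
  show "?e \<noteq> 0" if "crossing_switches xs ys \<noteq> {}" using cross that by fastforce
  show "signed_pos n ys p = - signed_pos n xs p"
    if p: "p \<in> set xs" and small: "\<bar>signed_pos n xs p\<bar> \<le> int ?e"
  proof -
    have nz: "signed_pos n xs p \<noteq> 0" using signed_pos_bounds[OF dist len p] by simp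
    then have "crossing_switches xs ys \<noteq> {}" using small by (auto simp: crossing_half_def)
    then obtain M where M: "M \<in> crossing_switches xs ys" by blast
    have "n - ?e < pos xs p \<and> pos xs p \<le> n + ?e"
      using small pos_bounds[OF dist p] by (auto simp: signed_pos_def split: if_splits)
    then have "pos xs p + pos ys p = 2 * n + 1" using cross[OF M] p by blast
    then show ?thesis by (auto simp: signed_pos_def)
  qed
  show "\<bar>signed_pos n ys p - signed_pos n xs p\<bar> \<le> 1 \<and> (0 < signed_pos n ys p \<longleftrightarrow> 0 < signed_pos n xs p)"
    if p: "p \<in> set xs" and large: "int ?e < \<bar>signed_pos n xs p\<bar>"
  proof -
    obtain b where b: "b \<in> set bs" "p \<in> set b" using block_of[OF bs p] by blast
    obtain a where a: "a < pos xs p" "pos xs p \<le> a + length b" "a < pos ys p" "pos ys p \<le> a + length b"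
      "centered_substring xs b \<longleftrightarrow> 2 * a + length b = length xs"
      using block_positions[OF dist bs b(1)] p b(2) by metis
    have not_crossing: "b \<notin> crossing_switches xs ys"
    proof
      assume "b \<in> crossing_switches xs ys"
      then have "n - ?e < pos xs p" "pos xs p \<le> n + ?e" using cross p b(2) by blast+
      then show False using large by (auto simp: signed_pos_def split: if_splits)
    qed
    show ?thesis
    proof (cases "2 \<le> length b")
      case True
      then have "b \<in> switches xs ys" using bs b(1) by (auto simp: switches_def)
      then have "length b = 2" "\<not> centered_substring xs b"
        using short not_crossing by (auto simp: crossing_switches_def)
      then have "a + 1 \<noteq> n" using a(5) len by simp
      then show ?thesis using a(1-4) \<open>length b = 2\<close> by (auto simp: signed_pos_def)
    next
      case False
      then have "pos ys p = pos xs p" using a(1-4) by linarith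
      then show ?thesis by (simp add: signed_pos_def)
    qed
  qed
qed

text \<open>
  The order of conjugate points \<open>p\<close> and \<open>q\<close> is given by the sign of \<open>p\<close>, so that they switch once
  means that this sign changes once.
\<close>

lemma realizes_central_motion:
  assumes "realizes P \<pi> d"
  obtains n k where "central_motion P (\<lambda>T. signed_pos n (\<pi> T)) (\<lambda>T. int (crossing_half (\<pi> (T - 1)) (\<pi> T))) (int n)"
    and "d = rotate k (map (\<lambda>T. crossing_half (\<pi> (T - 1)) (\<pi> T))
      (filter (\<lambda>T. crossing_half (\<pi> (T - 1)) (\<pi> T) \<noteq> 0) [1..2 * int n]))"
proof -
  obtain h where h: "allowable_with P \<pi> h"
    using assms(1) by (auto simp: realizes_def allowable_sequence_def)
  obtain n where n: "card P = 2 * n" "halfperiod_length P \<pi> = 2 * n"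
    using assms(1) by (auto simp: realizes_def even_near_critical_def)
  have hn: "h = 2 * n" using halfperiod_length_eq[OF h] n by simp
  note allow = h[unfolded hn allowable_with_def]
  have n0: "0 < n" and fin: "finite P" and half: "\<And>i. \<pi> (i + 2 * int n) = rev (\<pi> i)"
    and sw: "\<And>i. switches (\<pi> (i - 1)) (\<pi> i) \<noteq> {}"
    using allow by simp_all
  have dist: "distinct (\<pi> T)" and setP: "set (\<pi> T) = P" for T
    using allow by (auto simp: permutations_of_set_def)
  have len: "length (\<pi> T) = 2 * n" for T using dist setP n by (metis distinct_card)
  have short: "\<forall>b \<in> switches (\<pi> (i - 1)) (\<pi> i) - crossing_switches (\<pi> (i - 1)) (\<pi> i). length b = 2" for i
    using assms(1) by (simp add: realizes_def noncentral_general_position_def)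
  define G where "G T = signed_pos n (\<pi> T)" for T
  define e where "e T = int (crossing_half (\<pi> (T - 1)) (\<pi> T))" for T
  note move = central_move_heights[OF dist len sw short]
  have anti: "G (T + 2 * int n) p = - G T p" if "p \<in> P" for T p
  proof -
    have "pos (\<pi> (T + 2 * int n)) p + pos (\<pi> T) p = 2 * n + 1"
      using pos_rev[OF dist[of T], of p] that setP len[of T] by (simp add: half)
    then show ?thesis by (auto simp: G_def signed_pos_def)
  qed
  have order_once: "2 * int n dvd T - T'"
    if pq: "p \<in> P" "q \<in> P" "p \<noteq> q"
      and T: "(G (T - 1) p < G (T - 1) q) \<noteq> (G T p < G T q)" "(G (T' - 1) p < G (T' - 1) q) \<noteq> (G T' p < G T' q)"
    for p q T T'
  proof -
    let ?C = "\<lambda>i. (G (i - 1) p < G (i - 1) q) \<noteq> (G i p < G i q)"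
    have "\<exists>!i. i \<in> {1..int (2 * n)} \<and> (\<exists>b\<in>switches (\<pi> (i - 1)) (\<pi> i). p \<in> set b \<and> q \<in> set b)"
      using allow pq by blast
    moreover have "(\<exists>b\<in>switches (\<pi> (i - 1)) (\<pi> i). p \<in> set b \<and> q \<in> set b) \<longleftrightarrow> ?C i" for i
      unfolding G_def signed_pos_less using switch_iff_order_reversed[OF dist sw] pq setP by metis
    ultimately have once: "\<exists>!i. i \<in> {0 + 1..0 + 2 * int n} \<and> ?C i" by simp
    have per: "?C (i + 2 * int n) = ?C i" for i
    proof -
      have flip: "(G (T + 2 * int n) p < G (T + 2 * int n) q) = (\<not> G T p < G T q)" for T
      proof -
        have "G T p \<noteq> G T q" using signed_pos_inj[OF dist] pq setP unfolding G_def by metis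
        then show ?thesis using anti pq by auto
      qed
      have "i + 2 * int n - 1 = i - 1 + 2 * int n" by simp
      then show ?thesis using flip[of i] flip[of "i - 1"] by (simp only:) blast
    qed
    have "0 < 2 * int n" using n0 by simp
    from iffD1[OF periodic_unique_iff[of "2 * int n" ?C 0, OF this per] once]
    obtain x where "\<forall>i. ?C i \<longleftrightarrow> 2 * int n dvd i - x" ..
    then have "2 * int n dvd T - x" "2 * int n dvd T' - x" using T by blast+
    then have "2 * int n dvd (T - x) - (T' - x)" by (rule dvd_diff)
    then show ?thesis by simp
  qed
  have motion: "central_motion P G e (int n)"
  proof
    show "0 < int n" using n0 by simp
    show "bij_betw (G T) P ({- int n..int n} - {0})" for T
    proof -
      have inj: "inj_on (G T) P"
        using signed_pos_inj[OF dist[of T]] setP by (auto simp: inj_on_def G_def)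
      have "G T ` P \<subseteq> {- int n..int n} - {0}"
      proof (rule image_subsetI)
        fix p assume "p \<in> P"
        then show "G T p \<in> {- int n..int n} - {0}"
          unfolding G_def using setP by (intro signed_pos_bounds[OF dist len]) simp
      qed
      moreover have "card (G T ` P) = card ({- int n..int n} - {0})"
        using card_image[OF inj] n by simp
      ultimately show ?thesis using inj by (simp add: bij_betw_def card_subset_eq)
    qed
    show "G (T + 2 * int n) p = - G T p" if "p \<in> P" for p T using anti[OF that] .
    show "0 \<le> e T \<and> e T \<le> int n" for T using move(1) by (simp add: e_def)
    show "G T p = - G (T - 1) p" if "p \<in> P" "\<bar>G (T - 1) p\<bar> \<le> e T" for p T
      unfolding G_def using that setP by (intro move(3)) (simp_all add: G_def e_def)
    show "\<bar>G T p - G (T - 1) p\<bar> \<le> 1 \<and> (0 < G T p \<longleftrightarrow> 0 < G (T - 1) p)"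
      if "p \<in> P" "e T < \<bar>G (T - 1) p\<bar>" for p T
      unfolding G_def using that setP by (intro move(4)) (simp_all add: G_def e_def)
    show "G T q = G (T - 1) p" if pq: "p \<in> P" "q \<in> P" "G T p = G (T - 1) q" for p q T
    proof -
      obtain bs where bs: "reverses_blocks bs (\<pi> (T - 1)) (\<pi> T)"
        using sw[of T] by (auto simp: switches_def)
      have "int (pos (\<pi> T) p) = int (pos (\<pi> (T - 1)) q)"
        using pq(3) unfolding G_def pos_eq_signed[where n = n] by simp
      then have "pos (\<pi> T) q = pos (\<pi> (T - 1)) p"
        using pq(1,2) setP by (intro reverses_blocks_exchange[OF dist bs, of p q]) simp_all
      then show ?thesis by (simp only: G_def signed_pos_def)
    qed
    show "2 * int n dvd T - T'" if "p \<in> P" "q \<in> P" "p \<noteq> q"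
      "(G (T - 1) p < G (T - 1) q) \<noteq> (G T p < G T q)" "(G (T' - 1) p < G (T' - 1) q) \<noteq> (G T' p < G T' q)"
      for p q T T' using order_once that .
    show "2 * int n dvd T - T'" if p: "p \<in> P" and T: "(0 < G (T - 1) p) \<noteq> (0 < G T p)" "(0 < G (T' - 1) p) \<noteq> (0 < G T' p)"
      for p T T'
    proof -
      obtain n' where n': "card P = 2 * n'" "\<forall>p\<in>P. \<exists>q\<in>P. \<forall>i. pos (\<pi> i) p + pos (\<pi> i) q = 2 * n' + 1"
        using assms(1) by (auto simp: realizes_def centrally_symmetric_def)
      then obtain q where q: "q \<in> P" "\<And>i. pos (\<pi> i) p + pos (\<pi> i) q = 2 * n + 1"
        using p n by auto
      have "p \<noteq> q"
      proof
        assume "p = q"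
        then have "2 * pos (\<pi> 0) p = Suc (2 * n)" using q(2)[of 0] by simp
        then show False by (simp only: double_not_eq_Suc_double)
      qed
      moreover have "G i q < G i p \<longleftrightarrow> 0 < G i p" for i
        using q(2)[of i] unfolding G_def signed_pos_less by (auto simp: signed_pos_def)
      ultimately show ?thesis using order_once[of q p T T'] p q(1) T by simp
    qed
  qed
  obtain k where k: "d = rotate k (central_signature P \<pi>)"
    using assms(1) by (auto simp: realizes_def has_central_signature_def)
  have signature: "central_signature P \<pi> = map (\<lambda>T. crossing_half (\<pi> (T - 1)) (\<pi> T))
      (filter (\<lambda>T. crossing_half (\<pi> (T - 1)) (\<pi> T) \<noteq> 0) [1..2 * int n])"
  proof -
    have iff: "crossing_switches (\<pi> (i - 1)) (\<pi> i) \<noteq> {} \<longleftrightarrow> crossing_half (\<pi> (i - 1)) (\<pi> i) \<noteq> 0" for i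
      using move(2)[of i] by (auto simp: crossing_half_def)
    have "length (the_elem (crossing_switches (\<pi> (i - 1)) (\<pi> i))) div 2 = crossing_half (\<pi> (i - 1)) (\<pi> i)"
      if "crossing_half (\<pi> (i - 1)) (\<pi> i) \<noteq> 0" for i
      using that by (simp add: crossing_half_def split: if_splits)
    then show ?thesis unfolding central_signature_def n(2) iff by simp
  qed
  show thesis
    by (rule that[OF motion[unfolded G_def[abs_def] e_def[abs_def]]]) (use k signature in simp)
qed

theorem realizes_follows_heights:
  assumes "realizes P \<pi> d" and long: "length d > 1" and positive: "\<forall>x\<in>set d. 0 < x"
  shows "\<exists>idx m. follows_heights d P (\<lambda>T. \<pi> (T + m)) idx"
proof -
  obtain n k where motion: "central_motion P (\<lambda>T. signed_pos n (\<pi> T)) (\<lambda>T. int (crossing_half (\<pi> (T - 1)) (\<pi> T))) (int n)"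
    and sig: "d = rotate k (map (\<lambda>T. crossing_half (\<pi> (T - 1)) (\<pi> T))
      (filter (\<lambda>T. crossing_half (\<pi> (T - 1)) (\<pi> T) \<noteq> 0) [1..2 * int n]))"
    using realizes_central_motion[OF assms(1)] by blast
  have sig': "d = rotate k (map (\<lambda>T. nat (int (crossing_half (\<pi> (T - 1)) (\<pi> T))))
      (filter (\<lambda>T. int (crossing_half (\<pi> (T - 1)) (\<pi> T)) \<noteq> 0) [1..2 * int n]))"
    using sig by simp
  obtain idx m where "bij_betw idx P (points d)"
    "\<forall>T. \<forall>p\<in>P. signed_pos n (\<pi> (T + m)) p = point_height d (idx p) T"
    using central_motion.heights_determined(2)[OF motion long positive sig'] by blast
  moreover have "n = sum_list d"
    using central_motion.heights_determined(1)[OF motion long positive sig'] by simp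
  moreover have "\<pi> T \<in> permutations_of_set P" for T
    using assms(1) by (auto simp: realizes_def allowable_sequence_def allowable_with_def)
  ultimately show ?thesis unfolding follows_heights_def by blast
qed

text \<open>
  Match the points with equal labels: they have equal positions at all times.
\<close>

lemma equal_heights_equivalent:
  assumes P: "follows_heights d P (\<lambda>T. \<pi> (T + m)) idx" and Q: "follows_heights d Q (\<lambda>T. \<pi>' (T + m')) idx'"
  shows "combinatorially_equivalent P \<pi> Q \<pi>'"
proof -
  let ?n = "sum_list d"
  define f where "f = inv_into Q idx' \<circ> idx"
  have idx: "bij_betw idx P (points d)" "bij_betw idx' Q (points d)"
    using P Q unfolding follows_heights_def by blast+
  have perm: "\<pi> (T + m) \<in> permutations_of_set P" "\<pi>' (T + m') \<in> permutations_of_set Q" for T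
    using P Q unfolding follows_heights_def by blast+
  have height: "p \<in> P \<Longrightarrow> signed_pos ?n (\<pi> (T + m)) p = point_height d (idx p) T"
    "q \<in> Q \<Longrightarrow> signed_pos ?n (\<pi>' (T + m')) q = point_height d (idx' q) T" for p q T
    using P Q unfolding follows_heights_def by blast+
  have bij: "bij_betw f P Q"
    unfolding f_def by (rule bij_betw_trans[OF idx(1) bij_betw_inv_into[OF idx(2)]])
  have shift: "\<pi>' (T + m') = map f (\<pi> (T + m))" for T
  proof (rule nth_equalityI)
    have dist: "distinct (\<pi> (T + m))" "distinct (\<pi>' (T + m'))"
      and sets: "set (\<pi> (T + m)) = P" "set (\<pi>' (T + m')) = Q"
      using perm by (auto simp: permutations_of_set_def)
    show len: "length (\<pi>' (T + m')) = length (map f (\<pi> (T + m)))"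
      using bij_betw_same_card[OF bij] dist sets by (metis distinct_card length_map)
    fix k assume "k < length (\<pi>' (T + m'))"
    then have k: "k < length (\<pi> (T + m))" using len by simp
    define p where "p = \<pi> (T + m) ! k"
    have p: "p \<in> P" using k sets(1) by (auto simp: p_def)
    have fp: "f p \<in> Q" "idx' (f p) = idx p"
      using bij_betwE[OF bij] p bij_betw_inv_into_right[OF idx(2)] bij_betwE[OF idx(1)]
      by (auto simp: f_def)
    have "signed_pos ?n (\<pi>' (T + m')) (f p) = signed_pos ?n (\<pi> (T + m)) p"
      using height(1)[OF p] height(2)[OF fp(1)] fp(2) by simp
    then have "int (pos (\<pi>' (T + m')) (f p)) = int (pos (\<pi> (T + m)) p)"
      unfolding pos_eq_signed[where n = ?n] by simp
    then have "pos (\<pi>' (T + m')) (f p) = Suc k" using pos_nth[OF dist(1) k] by (simp add: p_def)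
    then show "\<pi>' (T + m') ! k = map f (\<pi> (T + m)) ! k"
      using nth_pos[OF dist(2), of "f p"] fp(1) sets(2) k by (simp add: p_def)
  qed
  have "\<pi>' (i + (m' - m)) = map f (\<pi> i)" for i using shift[of "i - m"] by (simp add: algebra_simps)
  then show ?thesis using bij unfolding combinatorially_equivalent_def by blast
qed

theorem theorem3p4:
  fixes d :: "nat list"
  assumes "length d > 1"
    and "\<forall>x\<in>set d. 0 < x"
  shows "(\<exists>(P :: nat set) \<pi>. realizes P \<pi> d) \<and>
    (\<forall>(P :: 'a set) \<pi> (Q :: 'b set) \<pi>'.
      realizes P \<pi> d \<longrightarrow> realizes Q \<pi>' d \<longrightarrow> combinatorially_equivalent P \<pi> Q \<pi>')"
proof (intro conjI allI impI)
  obtain idx where "bij_betw idx {0..<card (points d)} (points d)"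
    using ex_bij_betw_nat_finite[OF finite_points] by blast
  then show "\<exists>(P :: nat set) \<pi>. realizes P \<pi> d"
    using follows_heights_exists[OF assms] follows_heights_realizes[OF assms] by blast
next
  fix P :: "'a set" and \<pi> and Q :: "'b set" and \<pi>'
  assume "realizes P \<pi> d" "realizes Q \<pi>' d"
  then show "combinatorially_equivalent P \<pi> Q \<pi>'"
    using realizes_follows_heights[OF _ assms] equal_heights_equivalent by metis
qed

end
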